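(* Let $k$ be a commutative ring, and let $C$ be a dual $k$-linear category with underlying class $X$ such that all $C_{x,y}$ are finitely generated and projective $k$-modules. Let $A$ be the corresponding $k$-linear category, $A_{x,y}=C_{y,x}^*$. Then the category $\mathcal M_k^{\mathrm f}(X)^C$ of right $C$-comodules and the category $\mathcal M_k^{\mathrm f}(X)_A$ of right $A$-modules are isomorphic.
   Context: $\mathcal M_k^{\mathrm f}$ is the monoidal category of finitely generated projective $k$-modules; $\otimes=\otimes_k$, $(-)^*=\mathrm{Hom}_k(-,k)$. $\mathcal M_k^{\mathrm f}(X)$ is the category of families $M=(M_{x,y})_{x,y\in X}$ of objects of $\mathcal M_k^{\mathrm f}$, with families of $k$-linear maps as morphisms. A dual $k$-linear category $C$ with underlying class $X$ consists of $k$-modules $C_{x,y}$ and $k$-linear maps $\Delta_{x,y,z}:C_{x,z}\to C_{x,y}\otimes C_{y,z}$, written $\Delta_{x,y,z}(c)=c_{(1,y)}\otimes c_{(2,y)}$, and $\varepsilon_x:C_{x,x}\to k$, such that $(\Delta_{x,y,z}\otimes \mathrm{id})\circ\Delta_{x,z,u}=(\mathrm{id}\otimes\Delta_{y,z,u})\circ\Delta_{x,y,u}$ and $(\varepsilon_x\otimes\mathrm{id})\circ\Delta_{x,x,y}=\mathrm{id}=(\mathrm{id}\otimes\varepsilon_y)\circ\Delta_{x,y,y}$. The corresponding $k$-linear category $A$ (category enriched in $k$-modules) has $A_{x,y}=C_{y,x}^*$, multiplication maps $A_{x,y}\otimes A_{y,z}\to A_{x,z}$ given by $\langle ab,c\rangle=\langle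 a,c_{(2,y)}\rangle\langle b,c_{(1,y)}\rangle$ for $a\in A_{x,y}$, $b\in A_{y,z}$, $c\in C_{z,x}$, and unit elements $\varepsilon_x\in A_{x,x}=C_{x,x}^*$. A right $C$-comodule is $M\in\mathcal M_k^{\mathrm f}(X)$ with $k$-linear maps $\rho_{x,y,z}:M_{x,z}\to M_{x,y}\otimes C_{y,z}$, such that $(\rho_{x,u,y}\otimes \mathrm{id})\circ\rho_{x,y,z}=(\mathrm{id}\otimes\Delta_{u,y,z})\circ\rho_{x,u,z}$ and $(\mathrm{id}\otimes\varepsilon_z)\circ\rho_{x,z,z}=\mathrm{id}_{M_{x,z}}$; morphisms are morphisms in $\mathcal M_k^{\mathrm f}(X)$ commuting with the coactions. A right $A$-module is $M\in\mathcal M_k^{\mathrm f}(X)$ with $k$-linear maps $M_{x,y}\otimes A_{y,z}\to M_{x,z}$, $m\otimes a\mapsto ma$, such that $(ma)b=m(ab)$ and $m1_y=m$ for $m\in M_{x,y}$, where $1_y\in A_{y,y}$ is the unit element; morphisms are morphisms in $\mathcal M_k^{\mathrm f}(X)$ commuting with the actions. *)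

theory Defs
  imports "HOL-Algebra.Module" "HOL-Algebra.AbelCoset" "HOL-Library.FuncSet"
begin

section \<open>Linear maps and finitely generated projective modules\<close>

text \<open>Linear maps are extensional functions, so that equality of maps is equality on the carrier.\<close>

definition linear_maps :: "'k ring \<Rightarrow> ('k, 'm) module \<Rightarrow> ('k, 'n) module \<Rightarrow> ('m \<Rightarrow> 'n) set" where
  "linear_maps k M N = {f \<in> carrier M \<rightarrow>\<^sub>E carrier N.
     (\<forall>a\<in>carrier M. \<forall>b\<in>carrier M. f (a \<oplus>\<^bsub>M\<^esub> b) = f a \<oplus>\<^bsub>N\<^esub> f b) \<and>
     (\<forall>r\<in>carrier k. \<forall>a\<in>carrier M. f (r \<odot>\<^bsub>M\<^esub> a) = r \<odot>\<^bsub>N\<^esub> f a)}"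

definition id_map :: "('k, 'm) module \<Rightarrow> 'm \<Rightarrow> 'm" where
  "id_map M = (\<lambda>a\<in>carrier M. a)"

definition ring_module :: "'k ring \<Rightarrow> ('k, 'k) module" where
  "ring_module k = \<lparr>carrier = carrier k, mult = mult k, one = one k,
     zero = zero k, add = add k, smult = mult k\<rparr>"

definition dual_module :: "'k ring \<Rightarrow> ('k, 'm) module \<Rightarrow> ('k, 'm \<Rightarrow> 'k) module" where
  "dual_module k M = \<lparr>carrier = linear_maps k M (ring_module k), mult = undefined, one = undefined,
     zero = (\<lambda>c\<in>carrier M. \<zero>\<^bsub>k\<^esub>),
     add = (\<lambda>a b. \<lambda>c\<in>carrier M. a c \<oplus>\<^bsub>k\<^esub> b c),
     smult = (\<lambda>r a. \<lambda>c\<in>carrier M. r \<otimes>\<^bsub>k\<^esub> a c)\<rparr>"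

text \<open>The free module on \<open>B\<close>: finitely supported functions that vanish outside \<open>B\<close>.\<close>

definition supp :: "'k ring \<Rightarrow> ('b \<Rightarrow> 'k) \<Rightarrow> 'b set" where
  "supp k u = {b. u b \<noteq> \<zero>\<^bsub>k\<^esub>}"

definition free_module :: "'k ring \<Rightarrow> 'b set \<Rightarrow> ('k, 'b \<Rightarrow> 'k) module" where
  "free_module k B = \<lparr>carrier = {u. range u \<subseteq> carrier k \<and> finite (supp k u) \<and> supp k u \<subseteq> B},
     mult = undefined, one = undefined,
     zero = (\<lambda>b. \<zero>\<^bsub>k\<^esub>),
     add = (\<lambda>u v b. u b \<oplus>\<^bsub>k\<^esub> v b),
     smult = (\<lambda>r u b. r \<otimes>\<^bsub>k\<^esub> u b)\<rparr>"

definition basis_elem :: "'k ring \<Rightarrow> 'b \<Rightarrow> 'b \<Rightarrow> 'k" where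
  "basis_elem k b = (\<lambda>b'. if b' = b then \<one>\<^bsub>k\<^esub> else \<zero>\<^bsub>k\<^esub>)"

definition generated_submodule :: "'k ring \<Rightarrow> ('k, 'm) module \<Rightarrow> 'm set \<Rightarrow> 'm set" where
  "generated_submodule k M S = \<Inter>{H. submodule H k M \<and> S \<subseteq> H}"

definition finitely_generated :: "'k ring \<Rightarrow> ('k, 'm) module \<Rightarrow> bool" where
  "finitely_generated k M \<longleftrightarrow>
     (\<exists>S. finite S \<and> S \<subseteq> carrier M \<and> generated_submodule k M S = carrier M)"

text \<open>Projective means being a direct summand (a retract) of a free module.  Taking the basis
  inside the type of \<open>P\<close> is no restriction: a projective \<open>P\<close> is a retract of the free module on
  its own carrier.\<close>

definition projective :: "'k ring \<Rightarrow> ('k, 'm) module \<Rightarrow> bool" where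
  "projective k P \<longleftrightarrow>
     (\<exists>B :: 'm set. \<exists>s \<in> linear_maps k P (free_module k B). \<exists>p \<in> linear_maps k (free_module k B) P.
        \<forall>a\<in>carrier P. p (s a) = a)"


section \<open>Tensor products\<close>

definition quotient_module :: "'k ring \<Rightarrow> ('k, 'm) module \<Rightarrow> 'm set \<Rightarrow> ('k, 'm set) module" where
  "quotient_module k M H = \<lparr>carrier = a_rcosets\<^bsub>M\<^esub> H, mult = undefined, one = undefined,
     zero = H, add = set_add M, smult = (\<lambda>r U. \<Union>u\<in>U. H +>\<^bsub>M\<^esub> (r \<odot>\<^bsub>M\<^esub> u))\<rparr>"

definition tensor_free :: "'k ring \<Rightarrow> ('k, 'm) module \<Rightarrow> ('k, 'n) module \<Rightarrow>
    ('k, 'm \<times> 'n \<Rightarrow> 'k) module" where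
  "tensor_free k M N = free_module k (carrier M \<times> carrier N)"

definition tensor_relations :: "'k ring \<Rightarrow> ('k, 'm) module \<Rightarrow> ('k, 'n) module \<Rightarrow>
    ('m \<times> 'n \<Rightarrow> 'k) set" where
  "tensor_relations k M N =
     (let F = tensor_free k M N; e = basis_elem k in
       {e (m \<oplus>\<^bsub>M\<^esub> m', n) \<ominus>\<^bsub>F\<^esub> (e (m, n) \<oplus>\<^bsub>F\<^esub> e (m', n)) | m m' n.
          m \<in> carrier M \<and> m' \<in> carrier M \<and> n \<in> carrier N} \<union>
       {e (m, n \<oplus>\<^bsub>N\<^esub> n') \<ominus>\<^bsub>F\<^esub> (e (m, n) \<oplus>\<^bsub>F\<^esub> e (m, n')) | m n n'.
          m \<in> carrier M \<and> n \<in> carrier N \<and> n' \<in> carrier N} \<union>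
       {e (r \<odot>\<^bsub>M\<^esub> m, n) \<ominus>\<^bsub>F\<^esub> (r \<odot>\<^bsub>F\<^esub> e (m, n)) | r m n.
          r \<in> carrier k \<and> m \<in> carrier M \<and> n \<in> carrier N} \<union>
       {e (m, r \<odot>\<^bsub>N\<^esub> n) \<ominus>\<^bsub>F\<^esub> (r \<odot>\<^bsub>F\<^esub> e (m, n)) | r m n.
          r \<in> carrier k \<and> m \<in> carrier M \<and> n \<in> carrier N})"

definition tensor_kernel :: "'k ring \<Rightarrow> ('k, 'm) module \<Rightarrow> ('k, 'n) module \<Rightarrow>
    ('m \<times> 'n \<Rightarrow> 'k) set" where
  "tensor_kernel k M N = generated_submodule k (tensor_free k M N) (tensor_relations k M N)"

definition tensor :: "'k ring \<Rightarrow> ('k, 'm) module \<Rightarrow> ('k, 'n) module \<Rightarrow>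
    ('k, ('m \<times> 'n \<Rightarrow> 'k) set) module" where
  "tensor k M N = quotient_module k (tensor_free k M N) (tensor_kernel k M N)"

definition pure_tensor :: "'k ring \<Rightarrow> ('k, 'm) module \<Rightarrow> ('k, 'n) module \<Rightarrow> 'm \<Rightarrow> 'n \<Rightarrow>
    ('m \<times> 'n \<Rightarrow> 'k) set" where
  "pure_tensor k M N m n = tensor_kernel k M N +>\<^bsub>tensor_free k M N\<^esub> basis_elem k (m, n)"

text \<open>The linear map \<open>M \<otimes> N \<rightarrow> P\<close> induced by a bilinear map \<open>b\<close>: on the class of
  \<open>u\<close>, its value is \<open>\<Sum> u(m,n) b(m,n)\<close>, which for bilinear \<open>b\<close> is independent of the
  representative.\<close>

definition tensor_lift :: "'k ring \<Rightarrow> ('k, 'm) module \<Rightarrow> ('k, 'n) module \<Rightarrow> ('k, 'p) module \<Rightarrow>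
    ('m \<Rightarrow> 'n \<Rightarrow> 'p) \<Rightarrow> ('m \<times> 'n \<Rightarrow> 'k) set \<Rightarrow> 'p" where
  "tensor_lift k M N P b = (\<lambda>t\<in>carrier (tensor k M N).
     the_elem ((\<lambda>u. \<Oplus>\<^bsub>P\<^esub>q\<in>supp k u. u q \<odot>\<^bsub>P\<^esub> b (fst q) (snd q)) ` t))"

definition tensor_map :: "'k ring \<Rightarrow> ('k, 'm) module \<Rightarrow> ('k, 'n) module \<Rightarrow> ('k, 'p) module \<Rightarrow>
    ('k, 'q) module \<Rightarrow> ('m \<Rightarrow> 'p) \<Rightarrow> ('n \<Rightarrow> 'q) \<Rightarrow>
    ('m \<times> 'n \<Rightarrow> 'k) set \<Rightarrow> ('p \<times> 'q \<Rightarrow> 'k) set" where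
  "tensor_map k M N P Q f g =
     tensor_lift k M N (tensor k P Q) (\<lambda>m n. pure_tensor k P Q (f m) (g n))"

text \<open>The canonical isomorphisms \<open>(L \<otimes> M) \<otimes> N \<rightarrow> L \<otimes> (M \<otimes> N)\<close>, \<open>k \<otimes> M \<rightarrow> M\<close>
  and \<open>M \<otimes> k \<rightarrow> M\<close>.\<close>

definition tensor_assoc :: "'k ring \<Rightarrow> ('k, 'l) module \<Rightarrow> ('k, 'm) module \<Rightarrow> ('k, 'n) module \<Rightarrow>
    (('l \<times> 'm \<Rightarrow> 'k) set \<times> 'n \<Rightarrow> 'k) set \<Rightarrow> ('l \<times> ('m \<times> 'n \<Rightarrow> 'k) set \<Rightarrow> 'k) set" where
  "tensor_assoc k L M N =
     tensor_lift k (tensor k L M) N (tensor k L (tensor k M N))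
       (\<lambda>t n. tensor_lift k L M (tensor k L (tensor k M N))
          (\<lambda>l m. pure_tensor k L (tensor k M N) l (pure_tensor k M N m n)) t)"

definition left_unitor :: "'k ring \<Rightarrow> ('k, 'm) module \<Rightarrow> ('k \<times> 'm \<Rightarrow> 'k) set \<Rightarrow> 'm" where
  "left_unitor k M = tensor_lift k (ring_module k) M M (\<lambda>r m. r \<odot>\<^bsub>M\<^esub> m)"

definition right_unitor :: "'k ring \<Rightarrow> ('k, 'm) module \<Rightarrow> ('m \<times> 'k \<Rightarrow> 'k) set \<Rightarrow> 'm" where
  "right_unitor k M = tensor_lift k M (ring_module k) M (\<lambda>m r. r \<odot>\<^bsub>M\<^esub> m)"


section \<open>Dual linear categories and linear categories\<close>

record ('x, 'k, 'c) dual_linear_cat =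
  comod_hom :: "'x \<Rightarrow> 'x \<Rightarrow> ('k, 'c) module"
  coprod :: "'x \<Rightarrow> 'x \<Rightarrow> 'x \<Rightarrow> 'c \<Rightarrow> ('c \<times> 'c \<Rightarrow> 'k) set"
  counit :: "'x \<Rightarrow> 'c \<Rightarrow> 'k"

locale dual_linear_category = cring k
  for k :: "'k ring" +
  fixes X :: "'x set" and C :: "('x, 'k, 'c) dual_linear_cat"
  assumes comod_hom_module: "\<lbrakk>x \<in> X; y \<in> X\<rbrakk> \<Longrightarrow> module k (comod_hom C x y)"
    and coprod_linear: "\<lbrakk>x \<in> X; y \<in> X; z \<in> X\<rbrakk> \<Longrightarrow>
      coprod C x y z
        \<in> linear_maps k (comod_hom C x z) (tensor k (comod_hom C x y) (comod_hom C y z))"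
    and counit_linear: "x \<in> X \<Longrightarrow> counit C x \<in> linear_maps k (comod_hom C x x) (ring_module k)"
    and coassoc: "\<lbrakk>x \<in> X; y \<in> X; z \<in> X; u \<in> X; c \<in> carrier (comod_hom C x u)\<rbrakk> \<Longrightarrow>
      tensor_assoc k (comod_hom C x y) (comod_hom C y z) (comod_hom C z u)
        (tensor_map k (comod_hom C x z) (comod_hom C z u)
           (tensor k (comod_hom C x y) (comod_hom C y z)) (comod_hom C z u)
           (coprod C x y z) (id_map (comod_hom C z u)) (coprod C x z u c))
      = tensor_map k (comod_hom C x y) (comod_hom C y u)
           (comod_hom C x y) (tensor k (comod_hom C y z) (comod_hom C z u))
           (id_map (comod_hom C x y)) (coprod C y z u) (coprod C x y u c)"
    and left_counit: "\<lbrakk>x \<in> X; y \<in> X; c \<in> carrier (comod_hom C x y)\<rbrakk> \<Longrightarrow>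
      left_unitor k (comod_hom C x y)
        (tensor_map k (comod_hom C x x) (comod_hom C x y) (ring_module k) (comod_hom C x y)
           (counit C x) (id_map (comod_hom C x y)) (coprod C x x y c)) = c"
    and right_counit: "\<lbrakk>x \<in> X; y \<in> X; c \<in> carrier (comod_hom C x y)\<rbrakk> \<Longrightarrow>
      right_unitor k (comod_hom C x y)
        (tensor_map k (comod_hom C x y) (comod_hom C y y) (comod_hom C x y) (ring_module k)
           (id_map (comod_hom C x y)) (counit C y) (coprod C x y y c)) = c"

text \<open>Composition in a linear category goes \<open>A\<^sub>x\<^sub>y \<otimes> A\<^sub>y\<^sub>z \<rightarrow> A\<^sub>x\<^sub>z\<close>.\<close>

record ('x, 'k, 'a) linear_cat =
  mod_hom :: "'x \<Rightarrow> 'x \<Rightarrow> ('k, 'a) module"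
  comp_map :: "'x \<Rightarrow> 'x \<Rightarrow> 'x \<Rightarrow> ('a \<times> 'a \<Rightarrow> 'k) set \<Rightarrow> 'a"
  unit_elem :: "'x \<Rightarrow> 'a"

text \<open>The multiplication is \<open>\<langle>ab, c\<rangle> = \<langle>a, c\<^sub>(\<^sub>2\<^sub>,\<^sub>y\<^sub>)\<rangle> \<langle>b, c\<^sub>(\<^sub>1\<^sub>,\<^sub>y\<^sub>)\<rangle>\<close>
  for \<open>a \<in> A\<^sub>x\<^sub>y = C\<^sub>y\<^sub>x\<^sup>*\<close>, \<open>b \<in> A\<^sub>y\<^sub>z = C\<^sub>z\<^sub>y\<^sup>*\<close> and \<open>c \<in> C\<^sub>z\<^sub>x\<close>.\<close>

definition dual_to_linear_cat :: "'k ring \<Rightarrow> ('x, 'k, 'c) dual_linear_cat \<Rightarrow>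
    ('x, 'k, 'c \<Rightarrow> 'k) linear_cat" where
  "dual_to_linear_cat k C =
     (let A = (\<lambda>x y. dual_module k (comod_hom C y x)) in
      \<lparr>mod_hom = A,
       comp_map = (\<lambda>x y z. tensor_lift k (A x y) (A y z) (A x z)
         (\<lambda>a b. \<lambda>c\<in>carrier (comod_hom C z x).
            tensor_lift k (comod_hom C z y) (comod_hom C y x) (ring_module k)
              (\<lambda>c1 c2. a c2 \<otimes>\<^bsub>k\<^esub> b c1) (coprod C z y x c))),
       unit_elem = counit C\<rparr>)"


section \<open>Categories and isomorphisms of categories\<close>

record ('o, 'a) cat =
  Obj :: "'o set"
  Arr :: "'o \<Rightarrow> 'o \<Rightarrow> 'a set"
  Ident :: "'o \<Rightarrow> 'a"
  Compose :: "'o \<Rightarrow> 'o \<Rightarrow> 'o \<Rightarrow> 'a \<Rightarrow> 'a \<Rightarrow> 'a"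

text \<open>\<open>Compose \<C> P Q R g f\<close> is the composite of \<open>f : P \<rightarrow> Q\<close> followed by \<open>g : Q \<rightarrow> R\<close>.\<close>

locale category =
  fixes \<C> :: "('o, 'a) cat"
  assumes Ident_in: "P \<in> Obj \<C> \<Longrightarrow> Ident \<C> P \<in> Arr \<C> P P"
    and Compose_in: "\<lbrakk>P \<in> Obj \<C>; Q \<in> Obj \<C>; R \<in> Obj \<C>; f \<in> Arr \<C> P Q; g \<in> Arr \<C> Q R\<rbrakk> \<Longrightarrow>
      Compose \<C> P Q R g f \<in> Arr \<C> P R"
    and Ident_left: "\<lbrakk>P \<in> Obj \<C>; Q \<in> Obj \<C>; f \<in> Arr \<C> P Q\<rbrakk> \<Longrightarrow>
      Compose \<C> P Q Q (Ident \<C> Q) f = f"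
    and Ident_right: "\<lbrakk>P \<in> Obj \<C>; Q \<in> Obj \<C>; f \<in> Arr \<C> P Q\<rbrakk> \<Longrightarrow>
      Compose \<C> P P Q f (Ident \<C> P) = f"
    and Compose_assoc: "\<lbrakk>P \<in> Obj \<C>; Q \<in> Obj \<C>; R \<in> Obj \<C>; S \<in> Obj \<C>;
        f \<in> Arr \<C> P Q; g \<in> Arr \<C> Q R; h \<in> Arr \<C> R S\<rbrakk> \<Longrightarrow>
      Compose \<C> P R S h (Compose \<C> P Q R g f) = Compose \<C> P Q S (Compose \<C> Q R S h g) f"

locale cat_functor = source: category \<C> + target: category \<D>
  for \<C> :: "('o, 'a) cat" and \<D> :: "('p, 'b) cat" +
  fixes Fo :: "'o \<Rightarrow> 'p" and Fa :: "'o \<Rightarrow> 'o \<Rightarrow> 'a \<Rightarrow> 'b"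
  assumes Fo_in: "P \<in> Obj \<C> \<Longrightarrow> Fo P \<in> Obj \<D>"
    and Fa_in: "\<lbrakk>P \<in> Obj \<C>; Q \<in> Obj \<C>; f \<in> Arr \<C> P Q\<rbrakk> \<Longrightarrow> Fa P Q f \<in> Arr \<D> (Fo P) (Fo Q)"
    and Fa_Ident: "P \<in> Obj \<C> \<Longrightarrow> Fa P P (Ident \<C> P) = Ident \<D> (Fo P)"
    and Fa_Compose: "\<lbrakk>P \<in> Obj \<C>; Q \<in> Obj \<C>; R \<in> Obj \<C>; f \<in> Arr \<C> P Q; g \<in> Arr \<C> Q R\<rbrakk> \<Longrightarrow>
      Fa P R (Compose \<C> P Q R g f) = Compose \<D> (Fo P) (Fo Q) (Fo R) (Fa Q R g) (Fa P Q f)"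

definition isomorphic_categories :: "('o, 'a) cat \<Rightarrow> ('p, 'b) cat \<Rightarrow> bool" where
  "isomorphic_categories \<C> \<D> \<longleftrightarrow>
     (\<exists>Fo Fa Go Ga. cat_functor \<C> \<D> Fo Fa \<and> cat_functor \<D> \<C> Go Ga \<and>
        (\<forall>P\<in>Obj \<C>. Go (Fo P) = P) \<and>
        (\<forall>P\<in>Obj \<C>. \<forall>Q\<in>Obj \<C>. \<forall>f\<in>Arr \<C> P Q. Ga (Fo P) (Fo Q) (Fa P Q f) = f) \<and>
        (\<forall>P\<in>Obj \<D>. Fo (Go P) = P) \<and>
        (\<forall>P\<in>Obj \<D>. \<forall>Q\<in>Obj \<D>. \<forall>f\<in>Arr \<D> P Q. Fa (Go P) (Go Q) (Ga P Q f) = f))"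


section \<open>Families of modules, comodules and modules\<close>

text \<open>A module record also fixes values of its operations outside the carrier, as well as the
  ring fields \<open>mult\<close> and \<open>one\<close>, which mean nothing for a module.  Objects of the categories below
  carry fixed values there, so that equality of objects is equality of modules.\<close>

definition normalized_module :: "'k ring \<Rightarrow> ('k, 'm) module \<Rightarrow> bool" where
  "normalized_module k M \<longleftrightarrow>
     mult M = undefined \<and> one M = undefined \<and>
     add M = (\<lambda>a\<in>carrier M. \<lambda>b\<in>carrier M. a \<oplus>\<^bsub>M\<^esub> b) \<and>
     smult M = (\<lambda>r\<in>carrier k. \<lambda>a\<in>carrier M. r \<odot>\<^bsub>M\<^esub> a)"

definition fgp_modules :: "'k ring \<Rightarrow> ('k, 'm) module set" where
  "fgp_modules k =
     {M. module k M \<and> finitely_generated k M \<and> projective k M \<and> normalized_module k M}"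

type_synonym ('x, 'k, 'm) family = "'x \<Rightarrow> 'x \<Rightarrow> ('k, 'm) module"

definition fgp_families :: "'k ring \<Rightarrow> 'x set \<Rightarrow> ('x, 'k, 'm) family set" where
  "fgp_families k X = (\<Pi>\<^sub>E x\<in>X. \<Pi>\<^sub>E y\<in>X. fgp_modules k)"

definition family_maps :: "'k ring \<Rightarrow> 'x set \<Rightarrow> ('x, 'k, 'm) family \<Rightarrow> ('x, 'k, 'n) family \<Rightarrow>
    ('x \<Rightarrow> 'x \<Rightarrow> 'm \<Rightarrow> 'n) set" where
  "family_maps k X M N = (\<Pi>\<^sub>E x\<in>X. \<Pi>\<^sub>E y\<in>X. linear_maps k (M x y) (N x y))"

definition family_id :: "'x set \<Rightarrow> ('x, 'k, 'm) family \<Rightarrow> 'x \<Rightarrow> 'x \<Rightarrow> 'm \<Rightarrow> 'm" where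
  "family_id X M = (\<lambda>x\<in>X. \<lambda>y\<in>X. id_map (M x y))"

definition family_comp :: "'x set \<Rightarrow> ('x, 'k, 'm) family \<Rightarrow> ('x \<Rightarrow> 'x \<Rightarrow> 'n \<Rightarrow> 'p) \<Rightarrow>
    ('x \<Rightarrow> 'x \<Rightarrow> 'm \<Rightarrow> 'n) \<Rightarrow> 'x \<Rightarrow> 'x \<Rightarrow> 'm \<Rightarrow> 'p" where
  "family_comp X M g f = (\<lambda>x\<in>X. \<lambda>y\<in>X. compose (carrier (M x y)) (g x y) (f x y))"

type_synonym ('x, 'k, 'm, 'c) coaction = "'x \<Rightarrow> 'x \<Rightarrow> 'x \<Rightarrow> 'm \<Rightarrow> ('m \<times> 'c \<Rightarrow> 'k) set"

definition right_comodules :: "'k ring \<Rightarrow> 'x set \<Rightarrow> ('x, 'k, 'c) dual_linear_cat \<Rightarrow>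
    (('x, 'k, 'm) family \<times> ('x, 'k, 'm, 'c) coaction) set" where
  "right_comodules k X C = {(M, \<rho>).
     M \<in> fgp_families k X \<and>
     \<rho> \<in> (\<Pi>\<^sub>E x\<in>X. \<Pi>\<^sub>E y\<in>X. \<Pi>\<^sub>E z\<in>X. linear_maps k (M x z) (tensor k (M x y) (comod_hom C y z))) \<and>
     (\<forall>x\<in>X. \<forall>u\<in>X. \<forall>y\<in>X. \<forall>z\<in>X. \<forall>m\<in>carrier (M x z).
        tensor_assoc k (M x u) (comod_hom C u y) (comod_hom C y z)
          (tensor_map k (M x y) (comod_hom C y z)
             (tensor k (M x u) (comod_hom C u y)) (comod_hom C y z)
             (\<rho> x u y) (id_map (comod_hom C y z)) (\<rho> x y z m))
        = tensor_map k (M x u) (comod_hom C u z)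
             (M x u) (tensor k (comod_hom C u y) (comod_hom C y z))
             (id_map (M x u)) (coprod C u y z) (\<rho> x u z m)) \<and>
     (\<forall>x\<in>X. \<forall>z\<in>X. \<forall>m\<in>carrier (M x z).
        right_unitor k (M x z)
          (tensor_map k (M x z) (comod_hom C z z) (M x z) (ring_module k)
             (id_map (M x z)) (counit C z) (\<rho> x z z m)) = m)}"

definition comodule_maps :: "'k ring \<Rightarrow> 'x set \<Rightarrow> ('x, 'k, 'c) dual_linear_cat \<Rightarrow>
    ('x, 'k, 'm) family \<times> ('x, 'k, 'm, 'c) coaction \<Rightarrow>
    ('x, 'k, 'n) family \<times> ('x, 'k, 'n, 'c) coaction \<Rightarrow> ('x \<Rightarrow> 'x \<Rightarrow> 'm \<Rightarrow> 'n) set" where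
  "comodule_maps k X C = (\<lambda>(M, \<rho>) (N, \<sigma>). {f \<in> family_maps k X M N.
     \<forall>x\<in>X. \<forall>y\<in>X. \<forall>z\<in>X. \<forall>m\<in>carrier (M x z).
       tensor_map k (M x y) (comod_hom C y z) (N x y) (comod_hom C y z)
         (f x y) (id_map (comod_hom C y z)) (\<rho> x y z m)
       = \<sigma> x y z (f x z m)})"

definition comodule_category :: "'k ring \<Rightarrow> 'x set \<Rightarrow> ('x, 'k, 'c) dual_linear_cat \<Rightarrow>
    (('x, 'k, 'm) family \<times> ('x, 'k, 'm, 'c) coaction, 'x \<Rightarrow> 'x \<Rightarrow> 'm \<Rightarrow> 'm) cat" where
  "comodule_category k X C =
     \<lparr>Obj = right_comodules k X C,
      Arr = comodule_maps k X C,
      Ident = (\<lambda>P. family_id X (fst P)),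
      Compose = (\<lambda>P Q R. family_comp X (fst P))\<rparr>"

type_synonym ('x, 'k, 'm, 'a) action = "'x \<Rightarrow> 'x \<Rightarrow> 'x \<Rightarrow> ('m \<times> 'a \<Rightarrow> 'k) set \<Rightarrow> 'm"

definition act :: "'k ring \<Rightarrow> ('x, 'k, 'a) linear_cat \<Rightarrow> ('x, 'k, 'm) family \<Rightarrow>
    ('x, 'k, 'm, 'a) action \<Rightarrow> 'x \<Rightarrow> 'x \<Rightarrow> 'x \<Rightarrow> 'm \<Rightarrow> 'a \<Rightarrow> 'm" where
  "act k A M \<mu> x y z m a = \<mu> x y z (pure_tensor k (M x y) (mod_hom A y z) m a)"

definition right_modules :: "'k ring \<Rightarrow> 'x set \<Rightarrow> ('x, 'k, 'a) linear_cat \<Rightarrow>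
    (('x, 'k, 'm) family \<times> ('x, 'k, 'm, 'a) action) set" where
  "right_modules k X A = {(M, \<mu>).
     M \<in> fgp_families k X \<and>
     \<mu> \<in> (\<Pi>\<^sub>E x\<in>X. \<Pi>\<^sub>E y\<in>X. \<Pi>\<^sub>E z\<in>X. linear_maps k (tensor k (M x y) (mod_hom A y z)) (M x z)) \<and>
     (\<forall>x\<in>X. \<forall>y\<in>X. \<forall>z\<in>X. \<forall>u\<in>X.
        \<forall>m\<in>carrier (M x y). \<forall>a\<in>carrier (mod_hom A y z). \<forall>b\<in>carrier (mod_hom A z u).
          act k A M \<mu> x z u (act k A M \<mu> x y z m a) b
          = act k A M \<mu> x y u m
              (comp_map A y z u (pure_tensor k (mod_hom A y z) (mod_hom A z u) a b))) \<and>
     (\<forall>x\<in>X. \<forall>y\<in>X. \<forall>m\<in>carrier (M x y). act k A M \<mu> x y y m (unit_elem A y) = m)}"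

definition module_maps :: "'k ring \<Rightarrow> 'x set \<Rightarrow> ('x, 'k, 'a) linear_cat \<Rightarrow>
    ('x, 'k, 'm) family \<times> ('x, 'k, 'm, 'a) action \<Rightarrow>
    ('x, 'k, 'n) family \<times> ('x, 'k, 'n, 'a) action \<Rightarrow> ('x \<Rightarrow> 'x \<Rightarrow> 'm \<Rightarrow> 'n) set" where
  "module_maps k X A = (\<lambda>(M, \<mu>) (N, \<nu>). {f \<in> family_maps k X M N.
     \<forall>x\<in>X. \<forall>y\<in>X. \<forall>z\<in>X. \<forall>m\<in>carrier (M x y). \<forall>a\<in>carrier (mod_hom A y z).
       f x z (act k A M \<mu> x y z m a) = act k A N \<nu> x y z (f x y m) a})"

definition module_category :: "'k ring \<Rightarrow> 'x set \<Rightarrow> ('x, 'k, 'a) linear_cat \<Rightarrow>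
    (('x, 'k, 'm) family \<times> ('x, 'k, 'm, 'a) action, 'x \<Rightarrow> 'x \<Rightarrow> 'm \<Rightarrow> 'm) cat" where
  "module_category k X A =
     \<lparr>Obj = right_modules k X A,
      Arr = module_maps k X A,
      Ident = (\<lambda>P. family_id X (fst P)),
      Compose = (\<lambda>P Q R. family_comp X (fst P))\<rparr>"

text \<open>The categories of all comodules and modules whose underlying modules have elements of
  type \<open>'m\<close>.\<close>

type_synonym ('x, 'k, 'm, 'c) comodule_cat =
  "(('x, 'k, 'm) family \<times> ('x, 'k, 'm, 'c) coaction, 'x \<Rightarrow> 'x \<Rightarrow> 'm \<Rightarrow> 'm) cat"

type_synonym ('x, 'k, 'm, 'a) module_cat =
  "(('x, 'k, 'm) family \<times> ('x, 'k, 'm, 'a) action, 'x \<Rightarrow> 'x \<Rightarrow> 'm \<Rightarrow> 'm) cat"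

end

theory Submission
  imports Defs
begin

text \<open>
  A functional \<open>a \<in> C\<^sup>*\<close> contracts \<open>M \<otimes> C\<close> to \<open>M\<close>, so a coaction \<open>\<rho>\<close> yields the action
  \<open>m a = (id \<otimes> a)(\<rho> m)\<close>.  If \<open>C\<close> is finitely generated and projective it has a finite dual
  basis \<open>(c\<^sub>i, d\<^sub>i)\<close>, and \<open>t = \<Sum> (id \<otimes> d\<^sub>i)(t) \<otimes> c\<^sub>i\<close> for all \<open>t \<in> M \<otimes> C\<close>; hence the
  contractions separate the points of \<open>M \<otimes> C\<close>, and every linear map \<open>h : C\<^sup>* \<rightarrow> M\<close> is
  \<open>a \<mapsto> (id \<otimes> a)(t)\<close> for \<open>t = \<Sum> h(d\<^sub>i) \<otimes> c\<^sub>i\<close>.  Coactions thus correspond bijectively to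
  bilinear actions.  Since \<open>C\<^sub>u\<^sub>y \<otimes> C\<^sub>y\<^sub>z\<close> again has a dual basis, made of the functionals
  \<open>b \<otimes> a\<close>, contracting the coassociativity law with these gives exactly the associativity law of
  the action; the counit law and the morphism condition are compared in the same way.
\<close>


section \<open>Linear maps\<close>

lemma linear_mapsI:
  assumes "\<And>a. a \<in> carrier M \<Longrightarrow> f a \<in> carrier N"
    and "\<And>a. a \<notin> carrier M \<Longrightarrow> f a = undefined"
    and "\<And>a b. \<lbrakk>a \<in> carrier M; b \<in> carrier M\<rbrakk> \<Longrightarrow> f (a \<oplus>\<^bsub>M\<^esub> b) = f a \<oplus>\<^bsub>N\<^esub> f b"
    and "\<And>r a. \<lbrakk>r \<in> carrier k; a \<in> carrier M\<rbrakk> \<Longrightarrow> f (r \<odot>\<^bsub>M\<^esub> a) = r \<odot>\<^bsub>N\<^esub> f a"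
  shows "f \<in> linear_maps k M N"
  using assms by (auto simp: linear_maps_def PiE_def extensional_def)

lemma linear_maps_restrictI:
  assumes "module k M"
    and "\<And>a. a \<in> carrier M \<Longrightarrow> f a \<in> carrier N"
    and "\<And>a b. \<lbrakk>a \<in> carrier M; b \<in> carrier M\<rbrakk> \<Longrightarrow> f (a \<oplus>\<^bsub>M\<^esub> b) = f a \<oplus>\<^bsub>N\<^esub> f b"
    and "\<And>r a. \<lbrakk>r \<in> carrier k; a \<in> carrier M\<rbrakk> \<Longrightarrow> f (r \<odot>\<^bsub>M\<^esub> a) = r \<odot>\<^bsub>N\<^esub> f a"
  shows "(\<lambda>a\<in>carrier M. f a) \<in> linear_maps k M N"
proof -
  interpret module k M by fact
  show ?thesis by (rule linear_mapsI) (simp_all add: assms)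
qed

context
  fixes k :: "'k ring" and M :: "('k, 'm) module" and N :: "('k, 'n) module" and f
  assumes f: "f \<in> linear_maps k M N"
begin

lemma linear_maps_closed [simp, intro]: "a \<in> carrier M \<Longrightarrow> f a \<in> carrier N"
  using f by (auto simp: linear_maps_def)

lemma linear_maps_add:
  "\<lbrakk>a \<in> carrier M; b \<in> carrier M\<rbrakk> \<Longrightarrow> f (a \<oplus>\<^bsub>M\<^esub> b) = f a \<oplus>\<^bsub>N\<^esub> f b"
  using f by (auto simp: linear_maps_def)

lemma linear_maps_smult:
  "\<lbrakk>r \<in> carrier k; a \<in> carrier M\<rbrakk> \<Longrightarrow> f (r \<odot>\<^bsub>M\<^esub> a) = r \<odot>\<^bsub>N\<^esub> f a"
  using f by (auto simp: linear_maps_def)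

lemma linear_maps_eqI:
  assumes "g \<in> linear_maps k M N" and "\<And>a. a \<in> carrier M \<Longrightarrow> f a = g a"
  shows "f = g"
  using f assms by (intro extensionalityI[of _ "carrier M"]) (auto simp: linear_maps_def PiE_iff)

lemma linear_maps_zero:
  assumes "module k M" "module k N"
  shows "f \<zero>\<^bsub>M\<^esub> = \<zero>\<^bsub>N\<^esub>"
proof -
  interpret M: module k M by fact
  interpret N: module k N by fact
  have "f (\<zero>\<^bsub>k\<^esub> \<odot>\<^bsub>M\<^esub> \<zero>\<^bsub>M\<^esub>) = \<zero>\<^bsub>k\<^esub> \<odot>\<^bsub>N\<^esub> f \<zero>\<^bsub>M\<^esub>"
    by (rule linear_maps_smult) simp_all
  then show ?thesis by simp
qed

lemma linear_maps_a_inv: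
  assumes "module k M" "module k N" "a \<in> carrier M"
  shows "f (\<ominus>\<^bsub>M\<^esub> a) = \<ominus>\<^bsub>N\<^esub> f a"
proof -
  interpret M: module k M by fact
  interpret N: module k N by fact
  have "f ((\<ominus>\<^bsub>k\<^esub> \<one>\<^bsub>k\<^esub>) \<odot>\<^bsub>M\<^esub> a) = (\<ominus>\<^bsub>k\<^esub> \<one>\<^bsub>k\<^esub>) \<odot>\<^bsub>N\<^esub> f a"
    using assms(3) by (intro linear_maps_smult) simp_all
  then show ?thesis
    using assms(3) by (simp add: M.smult_l_minus N.smult_l_minus linear_maps_closed)
qed

lemma linear_maps_finsum:
  assumes "module k M" "module k N" "finite A" "g \<in> A \<rightarrow> carrier M"
  shows "f (finsum M g A) = (\<Oplus>\<^bsub>N\<^esub>i\<in>A. f (g i))"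
proof -
  interpret M: module k M by fact
  interpret N: module k N by fact
  show ?thesis
    using assms(3,4)
  proof (induction A rule: finite_induct)
    case empty
    then show ?case by (simp add: linear_maps_zero[OF assms(1,2)])
  next
    case (insert x A)
    then have "(\<lambda>i. f (g i)) \<in> insert x A \<rightarrow> carrier N" by auto
    with insert show ?case by (auto simp: linear_maps_add)
  qed
qed

end

lemma linear_maps_compose:
  assumes "module k M" "f \<in> linear_maps k M N" "g \<in> linear_maps k N P"
  shows "compose (carrier M) g f \<in> linear_maps k M P"
  unfolding compose_def using assms
  by (intro linear_maps_restrictI)
    (auto simp: linear_maps_add[OF assms(2)] linear_maps_add[OF assms(3)]
      linear_maps_smult[OF assms(2)] linear_maps_smult[OF assms(3)] linear_maps_closed)

lemma id_map_linear: "module k M \<Longrightarrow> id_map M \<in> linear_maps k M M"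
  unfolding id_map_def by (rule linear_maps_restrictI) simp_all

lemma id_map_apply [simp]: "a \<in> carrier M \<Longrightarrow> id_map M a = a"
  by (simp add: id_map_def)


section \<open>Quotient modules and free modules\<close>

lemma quotient_module_carrier:
  "carrier (quotient_module k M H) = (\<lambda>u. H +>\<^bsub>M\<^esub> u) ` carrier M"
  by (auto simp: quotient_module_def A_RCOSETS_def')

context
  fixes k :: "'k ring" and M :: "('k, 'm) module" and H
  assumes M: "module k M" and H: "submodule H k M"
begin

interpretation M: module k M by (rule M)

lemma submodule_abelian_subgroup: "abelian_subgroup H M"
  using H M.abelian_group_axioms
  by (intro abelian_subgroupI3 additive_subgroupI submodule.axioms)

interpretation H: abelian_subgroup H M by (rule submodule_abelian_subgroup)

lemma quotient_module_add:
  "\<lbrakk>u \<in> carrier M; v \<in> carrier M\<rbrakk> \<Longrightarrow>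
    (H +>\<^bsub>M\<^esub> u) \<oplus>\<^bsub>quotient_module k M H\<^esub> (H +>\<^bsub>M\<^esub> v) = H +>\<^bsub>M\<^esub> (u \<oplus>\<^bsub>M\<^esub> v)"
  by (simp add: quotient_module_def H.a_rcos_sum)

lemma coset_eq_iff:
  assumes "u \<in> carrier M" "v \<in> carrier M"
  shows "H +>\<^bsub>M\<^esub> u = H +>\<^bsub>M\<^esub> v \<longleftrightarrow> u \<ominus>\<^bsub>M\<^esub> v \<in> H"
proof -
  have "u \<ominus>\<^bsub>M\<^esub> v \<in> H \<longleftrightarrow> u \<in> H +>\<^bsub>M\<^esub> v"
    using H.a_rcos_module[OF assms(2,1)] by (simp add: a_minus_def)
  also have "\<dots> \<longleftrightarrow> H +>\<^bsub>M\<^esub> u = H +>\<^bsub>M\<^esub> v"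
    using H.a_repr_independence'[OF _ assms(2), of u] H.a_rcos_self[OF assms(1)] by auto
  finally show ?thesis by simp
qed

lemma quotient_module_smult:
  assumes r: "r \<in> carrier k" and u: "u \<in> carrier M"
  shows "r \<odot>\<^bsub>quotient_module k M H\<^esub> (H +>\<^bsub>M\<^esub> u) = H +>\<^bsub>M\<^esub> (r \<odot>\<^bsub>M\<^esub> u)"
proof -
  have "H +>\<^bsub>M\<^esub> (r \<odot>\<^bsub>M\<^esub> v) = H +>\<^bsub>M\<^esub> (r \<odot>\<^bsub>M\<^esub> u)" if v: "v \<in> H +>\<^bsub>M\<^esub> u" for v
  proof -
    have vM: "v \<in> carrier M" using v u H.a_elemrcos_carrier by blast
    have "H +>\<^bsub>M\<^esub> u = H +>\<^bsub>M\<^esub> v" by (rule H.a_repr_independence'[OF v u])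
    then have "u \<ominus>\<^bsub>M\<^esub> v \<in> H" using coset_eq_iff[OF u vM] by simp
    then have "r \<odot>\<^bsub>M\<^esub> (u \<ominus>\<^bsub>M\<^esub> v) \<in> H" by (rule submodule.smult_closed[OF H r])
    moreover have "r \<odot>\<^bsub>M\<^esub> (u \<ominus>\<^bsub>M\<^esub> v) = (r \<odot>\<^bsub>M\<^esub> u) \<ominus>\<^bsub>M\<^esub> (r \<odot>\<^bsub>M\<^esub> v)"
      using r u vM by (simp add: a_minus_def M.smult_r_distr M.smult_r_minus)
    ultimately show ?thesis using coset_eq_iff r u vM by (metis M.smult_closed)
  qed
  then have "(\<Union>v\<in>H +>\<^bsub>M\<^esub> u. H +>\<^bsub>M\<^esub> (r \<odot>\<^bsub>M\<^esub> v)) = (\<Union>v\<in>H +>\<^bsub>M\<^esub> u. H +>\<^bsub>M\<^esub> (r \<odot>\<^bsub>M\<^esub> u))"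
    by (intro SUP_cong refl)
  also have "\<dots> = H +>\<^bsub>M\<^esub> (r \<odot>\<^bsub>M\<^esub> u)"
    using H.a_rcos_self[OF u] by blast
  finally show ?thesis by (simp add: quotient_module_def)
qed

lemma quotient_module_zero: "\<zero>\<^bsub>quotient_module k M H\<^esub> = H +>\<^bsub>M\<^esub> \<zero>\<^bsub>M\<^esub>"
  using M.a_coset_add_zero[OF H.a_subset] by (simp add: quotient_module_def)

lemma quotient_module_module: "module k (quotient_module k M H)"
proof (rule moduleI)
  show "cring k" by (rule M.R.cring_axioms)
  show "abelian_group (quotient_module k M H)"
  proof (rule abelian_groupI)
    fix x assume "x \<in> carrier (quotient_module k M H)"
    then obtain u where u: "u \<in> carrier M" "x = H +>\<^bsub>M\<^esub> u" by (auto simp: quotient_module_carrier)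
    have "(H +>\<^bsub>M\<^esub> (\<ominus>\<^bsub>M\<^esub> u)) \<oplus>\<^bsub>quotient_module k M H\<^esub> x = \<zero>\<^bsub>quotient_module k M H\<^esub>"
      using u by (simp add: quotient_module_add quotient_module_zero M.l_neg)
    then show "\<exists>y\<in>carrier (quotient_module k M H).
        y \<oplus>\<^bsub>quotient_module k M H\<^esub> x = \<zero>\<^bsub>quotient_module k M H\<^esub>"
      using u(1) by (auto simp: quotient_module_carrier)
  qed (auto simp: quotient_module_carrier quotient_module_add quotient_module_zero M.a_ac)
qed (auto simp: quotient_module_carrier quotient_module_add quotient_module_smult
      M.smult_l_distr M.smult_r_distr M.smult_assoc1)

end

lemma generated_submodule_submodule:
  assumes M: "module k M" and S: "S \<subseteq> carrier M"
  shows "submodule (generated_submodule k M S) k M"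
proof -
  interpret module k M by fact
  note E = submoduleE
  have car: "submodule (carrier M) k M" by (rule carrier_is_submodule)
  show ?thesis
  proof (rule submoduleI)
    show "generated_submodule k M S \<subseteq> carrier M"
      using car S by (auto simp: generated_submodule_def)
    show "\<zero>\<^bsub>M\<^esub> \<in> generated_submodule k M S"
      by (auto simp: generated_submodule_def submodule_def dest: subgroup.one_closed)
  qed (auto simp: generated_submodule_def E)
qed

lemma generated_submodule_superset: "S \<subseteq> generated_submodule k M S"
  by (auto simp: generated_submodule_def)

lemma generated_submodule_least:
  "\<lbrakk>submodule H k M; S \<subseteq> H\<rbrakk> \<Longrightarrow> generated_submodule k M S \<subseteq> H"
  by (auto simp: generated_submodule_def)

lemma free_module_simps:
  "u \<in> carrier (free_module k B) \<longleftrightarrow>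
     range u \<subseteq> carrier k \<and> finite (supp k u) \<and> supp k u \<subseteq> B"
  "\<zero>\<^bsub>free_module k B\<^esub> = (\<lambda>b. \<zero>\<^bsub>k\<^esub>)"
  "u \<oplus>\<^bsub>free_module k B\<^esub> v = (\<lambda>b. u b \<oplus>\<^bsub>k\<^esub> v b)"
  "r \<odot>\<^bsub>free_module k B\<^esub> u = (\<lambda>b. r \<otimes>\<^bsub>k\<^esub> u b)"
  by (simp_all add: free_module_def)

lemma free_module_module:
  fixes k (structure)
  assumes "cring k"
  shows "module k (free_module k B)"
proof -
  interpret cring k by fact
  have supp_add: "supp k (\<lambda>b. u b \<oplus> v b) \<subseteq> supp k u \<union> supp k v"
    if "u \<in> carrier (free_module k B)" "v \<in> carrier (free_module k B)" for u v 
    by (auto simp: supp_def)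
  have supp_mult: "supp k (\<lambda>b. r \<otimes> u b) \<subseteq> supp k u" if "r \<in> carrier k" for r and u 
    using that by (auto simp: supp_def)
  have supp_inv: "supp k (\<lambda>b. \<ominus> u b) \<subseteq> supp k u" for u 
    by (auto simp: supp_def)
  have add_closed: "u \<oplus>\<^bsub>free_module k B\<^esub> v \<in> carrier (free_module k B)"
    if "u \<in> carrier (free_module k B)" "v \<in> carrier (free_module k B)" for u v
    using that supp_add[OF that]
    by (auto simp: free_module_simps image_subset_iff intro: finite_subset)
  have zero_closed: "\<zero>\<^bsub>free_module k B\<^esub> \<in> carrier (free_module k B)"
    by (auto simp: free_module_simps supp_def)
  have inv_closed: "(\<lambda>b. \<ominus> u b) \<in> carrier (free_module k B)"
    if "u \<in> carrier (free_module k B)" for u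
    using that supp_inv[of u]
    by (auto simp: free_module_simps image_subset_iff intro: finite_subset)
  show ?thesis
  proof (rule moduleI)
    show "abelian_group (free_module k B)"
    proof (rule abelian_groupI)
      fix u assume u: "u \<in> carrier (free_module k B)"
      show "\<exists>v\<in>carrier (free_module k B). v \<oplus>\<^bsub>free_module k B\<^esub> u = \<zero>\<^bsub>free_module k B\<^esub>"
        using u by (intro bexI[OF _ inv_closed[OF u]])
          (auto simp: free_module_simps image_subset_iff l_neg)
    qed (auto simp: add_closed zero_closed,
        auto simp: free_module_simps image_subset_iff a_ac)
  next
    fix r u assume "r \<in> carrier k" "u \<in> carrier (free_module k B)"
    then show "r \<odot>\<^bsub>free_module k B\<^esub> u \<in> carrier (free_module k B)"
      using supp_mult[of r u]
      by (auto simp: free_module_simps image_subset_iff intro: finite_subset)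
  qed (auto simp: free_module_simps image_subset_iff l_distr r_distr m_assoc cring_axioms)
qed

lemma basis_elem_closed:
  assumes "cring k" "b \<in> B"
  shows "basis_elem k b \<in> carrier (free_module k B)"
proof -
  interpret cring k by fact
  have "supp k (basis_elem k b) \<subseteq> {b}" by (auto simp: supp_def basis_elem_def)
  then show ?thesis
    using assms(2) by (auto simp: free_module_simps basis_elem_def intro: finite_subset)
qed

lemma free_module_induct [consumes 2, case_names zero add basis]:
  fixes k (structure)
  assumes k: "cring k" and u: "u \<in> carrier (free_module k B)"
    and zero: "P \<zero>\<^bsub>free_module k B\<^esub>"
    and add: "\<And>u v. \<lbrakk>u \<in> carrier (free_module k B); v \<in> carrier (free_module k B); P u; P v\<rbrakk> \<Longrightarrow>
      P (u \<oplus>\<^bsub>free_module k B\<^esub> v)"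
    and basis: "\<And>r b. \<lbrakk>r \<in> carrier k; b \<in> B\<rbrakk> \<Longrightarrow> P (r \<odot>\<^bsub>free_module k B\<^esub> basis_elem k b)"
  shows "P u"
proof -
  interpret cring k by fact
  interpret F: module k "free_module k B" by (rule free_module_module[OF k])
  have "finite (supp k u)" using u by (simp add: free_module_simps)
  then show ?thesis using u
  proof (induction "supp k u" arbitrary: u rule: finite_psubset_induct)
    case psubset
    have ucl: "u b \<in> carrier k" for b using psubset.prems by (auto simp: free_module_simps)
    show ?case
    proof (cases "supp k u = {}")
      case True
      then have "u = \<zero>\<^bsub>free_module k B\<^esub>" by (auto simp: supp_def free_module_simps)
      then show ?thesis using zero by simp
    next
      case False
      then obtain b where b: "b \<in> supp k u" by blast
      then have bB: "b \<in> B" using psubset.prems by (auto simp: free_module_simps)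
      define v where "v = u(b := \<zero>)"
      have supp_v: "supp k v = supp k u - {b}" by (auto simp: v_def supp_def)
      have v: "v \<in> carrier (free_module k B)"
        using psubset.prems unfolding free_module_simps supp_v by (auto simp: v_def)
      have "P v" by (rule psubset.hyps) (use b v supp_v in auto)
      moreover have "u = v \<oplus>\<^bsub>free_module k B\<^esub> (u b \<odot>\<^bsub>free_module k B\<^esub> basis_elem k b)"
        using ucl by (auto simp: v_def free_module_simps basis_elem_def)
      ultimately show ?thesis
        using add[OF v _ _ basis[OF ucl bB], of b] basis_elem_closed[OF k bB] ucl by simp
    qed
  qed
qed

definition free_lift :: "'k ring \<Rightarrow> ('k, 'p) module \<Rightarrow> ('b \<Rightarrow> 'p) \<Rightarrow> ('b \<Rightarrow> 'k) \<Rightarrow> 'p" where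
  "free_lift k P f u = (\<Oplus>\<^bsub>P\<^esub>q\<in>supp k u. u q \<odot>\<^bsub>P\<^esub> f q)"

context
  fixes k :: "'k ring" and P :: "('k, 'p) module" and B :: "'b set" and f :: "'b \<Rightarrow> 'p"
  assumes P: "module k P" and f: "\<And>b. b \<in> B \<Longrightarrow> f b \<in> carrier P"
begin

interpretation P: module k P by (rule P)
interpretation F: module k "free_module k B" by (rule free_module_module[OF P.R.cring_axioms])

lemma free_lift_superset:
  assumes "u \<in> carrier (free_module k B)" "finite S" "supp k u \<subseteq> S" "S \<subseteq> B"
  shows "free_lift k P f u = (\<Oplus>\<^bsub>P\<^esub>q\<in>S. u q \<odot>\<^bsub>P\<^esub> f q)"
  unfolding free_lift_def
  using assms f
  by (intro P.add.finprod_mono_neutral_cong_left)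
    (auto simp: free_module_simps supp_def image_subset_iff subset_iff)

lemma free_lift_closed:
  assumes "u \<in> carrier (free_module k B)"
  shows "free_lift k P f u \<in> carrier P"
  unfolding free_lift_def
  using assms f by (intro P.finsum_closed) (auto simp: free_module_simps image_subset_iff subset_iff)

lemma free_lift_add:
  assumes u: "u \<in> carrier (free_module k B)" and v: "v \<in> carrier (free_module k B)"
  shows "free_lift k P f (u \<oplus>\<^bsub>free_module k B\<^esub> v) = free_lift k P f u \<oplus>\<^bsub>P\<^esub> free_lift k P f v"
proof -
  define S where "S = supp k u \<union> supp k v"
  have S: "finite S" "S \<subseteq> B" using u v by (auto simp: S_def free_module_simps)
  have cl: "u b \<in> carrier k" "v b \<in> carrier k" for b
    using u v by (auto simp: free_module_simps)
  have "supp k (u \<oplus>\<^bsub>free_module k B\<^esub> v) \<subseteq> S"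
    by (auto simp: S_def supp_def free_module_simps)
  then have "free_lift k P f (u \<oplus>\<^bsub>free_module k B\<^esub> v) =
      (\<Oplus>\<^bsub>P\<^esub>q\<in>S. (u \<oplus>\<^bsub>free_module k B\<^esub> v) q \<odot>\<^bsub>P\<^esub> f q)"
    using S u v by (intro free_lift_superset) auto
  also have "\<dots> = (\<Oplus>\<^bsub>P\<^esub>q\<in>S. u q \<odot>\<^bsub>P\<^esub> f q \<oplus>\<^bsub>P\<^esub> v q \<odot>\<^bsub>P\<^esub> f q)"
    using S f cl by (intro P.finsum_cong') (auto simp: free_module_simps P.smult_l_distr subset_iff)
  also have "\<dots> = (\<Oplus>\<^bsub>P\<^esub>q\<in>S. u q \<odot>\<^bsub>P\<^esub> f q) \<oplus>\<^bsub>P\<^esub> (\<Oplus>\<^bsub>P\<^esub>q\<in>S. v q \<odot>\<^bsub>P\<^esub> f q)"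
    using S f cl by (intro P.finsum_addf) auto
  also have "\<dots> = free_lift k P f u \<oplus>\<^bsub>P\<^esub> free_lift k P f v"
    using free_lift_superset[OF u S(1) _ S(2)] free_lift_superset[OF v S(1) _ S(2)]
    by (simp add: S_def)
  finally show ?thesis .
qed

lemma free_lift_smult:
  assumes r: "r \<in> carrier k" and u: "u \<in> carrier (free_module k B)"
  shows "free_lift k P f (r \<odot>\<^bsub>free_module k B\<^esub> u) = r \<odot>\<^bsub>P\<^esub> free_lift k P f u"
proof -
  have S: "finite (supp k u)" "supp k u \<subseteq> B" and cl: "u b \<in> carrier k" for b
    using u by (auto simp: free_module_simps)
  have "supp k (r \<odot>\<^bsub>free_module k B\<^esub> u) \<subseteq> supp k u"
    using r by (auto simp: supp_def free_module_simps)
  then have "free_lift k P f (r \<odot>\<^bsub>free_module k B\<^esub> u) =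
      (\<Oplus>\<^bsub>P\<^esub>q\<in>supp k u. (r \<odot>\<^bsub>free_module k B\<^esub> u) q \<odot>\<^bsub>P\<^esub> f q)"
    using S r u by (intro free_lift_superset) auto
  also have "\<dots> = (\<Oplus>\<^bsub>P\<^esub>q\<in>supp k u. r \<odot>\<^bsub>P\<^esub> (u q \<odot>\<^bsub>P\<^esub> f q))"
    using S f cl r by (intro P.finsum_cong') (auto simp: free_module_simps P.smult_assoc1 subset_iff)
  also have "\<dots> = r \<odot>\<^bsub>P\<^esub> free_lift k P f u"
    unfolding free_lift_def using S f cl r by (intro P.finsum_smult_ldistr[symmetric]) auto
  finally show ?thesis .
qed

lemma free_lift_basis:
  assumes b: "b \<in> B"
  shows "free_lift k P f (basis_elem k b) = f b"
proof -
  have "free_lift k P f (basis_elem k b) = (\<Oplus>\<^bsub>P\<^esub>q\<in>{b}. basis_elem k b q \<odot>\<^bsub>P\<^esub> f q)"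
    using b by (intro free_lift_superset basis_elem_closed P.R.cring_axioms)
      (auto simp: supp_def basis_elem_def)
  also have "\<dots> = f b" using b f by (simp add: basis_elem_def)
  finally show ?thesis .
qed

lemma free_lift_linear: "(\<lambda>u\<in>carrier (free_module k B). free_lift k P f u) \<in> linear_maps k (free_module k B) P"
  by (intro linear_maps_restrictI F.module_axioms free_lift_closed free_lift_add free_lift_smult)

end

lemma free_module_linear_maps_agree:
  assumes k: "cring k" and P: "module k P"
    and f: "f \<in> linear_maps k (free_module k B) P" and g: "g \<in> linear_maps k (free_module k B) P"
    and eq: "\<And>b. b \<in> B \<Longrightarrow> f (basis_elem k b) = g (basis_elem k b)"
    and u: "u \<in> carrier (free_module k B)"
  shows "f u = g u"
  using k u
proof (induction rule: free_module_induct)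
  case zero
  show ?case by (simp add: linear_maps_zero[OF f free_module_module[OF k] P] linear_maps_zero[OF g free_module_module[OF k] P])
next
  case (add u v)
  then show ?case by (simp add: linear_maps_add[OF f] linear_maps_add[OF g])
next
  case (basis r b)
  then show ?case
    by (simp add: linear_maps_smult[OF f] linear_maps_smult[OF g] basis_elem_closed[OF k] eq)
qed


section \<open>Tensor products\<close>

locale bilinear_map =
  fixes k :: "'k ring" and M :: "('k, 'm) module" and N :: "('k, 'n) module"
    and P :: "('k, 'p) module" and b :: "'m \<Rightarrow> 'n \<Rightarrow> 'p"
  assumes closed: "\<lbrakk>m \<in> carrier M; n \<in> carrier N\<rbrakk> \<Longrightarrow> b m n \<in> carrier P"
    and add_left: "\<lbrakk>m \<in> carrier M; m' \<in> carrier M; n \<in> carrier N\<rbrakk> \<Longrightarrow>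
      b (m \<oplus>\<^bsub>M\<^esub> m') n = b m n \<oplus>\<^bsub>P\<^esub> b m' n"
    and add_right: "\<lbrakk>m \<in> carrier M; n \<in> carrier N; n' \<in> carrier N\<rbrakk> \<Longrightarrow>
      b m (n \<oplus>\<^bsub>N\<^esub> n') = b m n \<oplus>\<^bsub>P\<^esub> b m n'"
    and smult_left: "\<lbrakk>r \<in> carrier k; m \<in> carrier M; n \<in> carrier N\<rbrakk> \<Longrightarrow>
      b (r \<odot>\<^bsub>M\<^esub> m) n = r \<odot>\<^bsub>P\<^esub> b m n"
    and smult_right: "\<lbrakk>r \<in> carrier k; m \<in> carrier M; n \<in> carrier N\<rbrakk> \<Longrightarrow>
      b m (r \<odot>\<^bsub>N\<^esub> n) = r \<odot>\<^bsub>P\<^esub> b m n"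

context
  fixes k :: "'k ring" and M :: "('k, 'm) module" and N :: "('k, 'n) module"
  assumes M: "module k M" and N: "module k N"
begin

interpretation M: module k M by (rule M)
interpretation N: module k N by (rule N)

lemma tensor_free_module: "module k (tensor_free k M N)"
  unfolding tensor_free_def by (rule free_module_module[OF M.R.cring_axioms])

interpretation F: module k "tensor_free k M N" by (rule tensor_free_module)

lemma tensor_free_basis_closed:
  "\<lbrakk>m \<in> carrier M; n \<in> carrier N\<rbrakk> \<Longrightarrow> basis_elem k (m, n) \<in> carrier (tensor_free k M N)"
  unfolding tensor_free_def by (rule basis_elem_closed[OF M.R.cring_axioms]) simp

lemma tensor_relations_subset: "tensor_relations k M N \<subseteq> carrier (tensor_free k M N)"
  by (auto simp: tensor_relations_def Let_def tensor_free_basis_closed)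

lemma tensor_kernel_submodule: "submodule (tensor_kernel k M N) k (tensor_free k M N)"
  unfolding tensor_kernel_def
  by (rule generated_submodule_submodule[OF tensor_free_module tensor_relations_subset])

lemma tensor_module: "module k (tensor k M N)"
  unfolding tensor_def by (rule quotient_module_module[OF tensor_free_module tensor_kernel_submodule])

lemma tensor_carrier:
  "carrier (tensor k M N) =
    (\<lambda>u. tensor_kernel k M N +>\<^bsub>tensor_free k M N\<^esub> u) ` carrier (tensor_free k M N)"
  by (simp add: tensor_def quotient_module_carrier)

lemma tensor_relation_coset_eq:
  assumes "u \<ominus>\<^bsub>tensor_free k M N\<^esub> v \<in> tensor_relations k M N"
    "u \<in> carrier (tensor_free k M N)" "v \<in> carrier (tensor_free k M N)"
  shows "tensor_kernel k M N +>\<^bsub>tensor_free k M N\<^esub> u = tensor_kernel k M N +>\<^bsub>tensor_free k M N\<^esub> v"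
  using coset_eq_iff[OF tensor_free_module tensor_kernel_submodule assms(2,3)]
    subsetD[OF generated_submodule_superset assms(1)]
  by (simp add: tensor_kernel_def)

lemma bilinear_map_pure_tensor: "bilinear_map k M N (tensor k M N) (pure_tensor k M N)"
proof
  fix m n assume "m \<in> carrier M" "n \<in> carrier N"
  then show "pure_tensor k M N m n \<in> carrier (tensor k M N)"
    by (auto simp: tensor_carrier pure_tensor_def tensor_free_basis_closed)
next
  fix m m' n assume mn: "m \<in> carrier M" "m' \<in> carrier M" "n \<in> carrier N"
  show "pure_tensor k M N (m \<oplus>\<^bsub>M\<^esub> m') n =
      pure_tensor k M N m n \<oplus>\<^bsub>tensor k M N\<^esub> pure_tensor k M N m' n"
    unfolding pure_tensor_def tensor_def using mn
    by (simp add: quotient_module_add[OF tensor_free_module tensor_kernel_submodule]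
        tensor_free_basis_closed, intro tensor_relation_coset_eq)
      (auto simp: tensor_free_basis_closed tensor_relations_def Let_def)
next
  fix m n n' assume mn: "m \<in> carrier M" "n \<in> carrier N" "n' \<in> carrier N"
  show "pure_tensor k M N m (n \<oplus>\<^bsub>N\<^esub> n') =
      pure_tensor k M N m n \<oplus>\<^bsub>tensor k M N\<^esub> pure_tensor k M N m n'"
    unfolding pure_tensor_def tensor_def using mn
    by (simp add: quotient_module_add[OF tensor_free_module tensor_kernel_submodule]
        tensor_free_basis_closed, intro tensor_relation_coset_eq)
      (auto simp: tensor_free_basis_closed tensor_relations_def Let_def)
next
  fix r m n assume mn: "r \<in> carrier k" "m \<in> carrier M" "n \<in> carrier N"
  show "pure_tensor k M N (r \<odot>\<^bsub>M\<^esub> m) n = r \<odot>\<^bsub>tensor k M N\<^esub> pure_tensor k M N m n"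
    unfolding pure_tensor_def tensor_def using mn
    by (simp add: quotient_module_smult[OF tensor_free_module tensor_kernel_submodule]
        tensor_free_basis_closed, intro tensor_relation_coset_eq)
      (auto simp: tensor_free_basis_closed tensor_relations_def Let_def)
  show "pure_tensor k M N m (r \<odot>\<^bsub>N\<^esub> n) = r \<odot>\<^bsub>tensor k M N\<^esub> pure_tensor k M N m n"
    unfolding pure_tensor_def tensor_def using mn
    by (simp add: quotient_module_smult[OF tensor_free_module tensor_kernel_submodule]
        tensor_free_basis_closed, intro tensor_relation_coset_eq)
      (auto simp: tensor_free_basis_closed tensor_relations_def Let_def)
qed

lemma tensor_induct [consumes 1, case_names zero add pure]:
  assumes t: "t \<in> carrier (tensor k M N)"
    and zero: "Q \<zero>\<^bsub>tensor k M N\<^esub>"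
    and add: "\<And>s t. \<lbrakk>s \<in> carrier (tensor k M N); t \<in> carrier (tensor k M N); Q s; Q t\<rbrakk> \<Longrightarrow>
      Q (s \<oplus>\<^bsub>tensor k M N\<^esub> t)"
    and pure: "\<And>m n. \<lbrakk>m \<in> carrier M; n \<in> carrier N\<rbrakk> \<Longrightarrow> Q (pure_tensor k M N m n)"
  shows "Q t"
proof -
  interpret pt: bilinear_map k M N "tensor k M N" "pure_tensor k M N"
    by (rule bilinear_map_pure_tensor)
  obtain u where u: "u \<in> carrier (free_module k (carrier M \<times> carrier N))"
    and t_eq: "t = tensor_kernel k M N +>\<^bsub>tensor_free k M N\<^esub> u"
    using t by (auto simp: tensor_carrier tensor_free_def)
  show ?thesis
    unfolding t_eq using M.R.cring_axioms u
  proof (induction rule: free_module_induct)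
    case zero
    show ?case
      using assms(2) quotient_module_zero[OF tensor_free_module tensor_kernel_submodule]
      by (simp add: tensor_def tensor_free_def)
  next
    case (add u v)
    then show ?case
      using assms(3)[of "tensor_kernel k M N +>\<^bsub>tensor_free k M N\<^esub> u" "tensor_kernel k M N +>\<^bsub>tensor_free k M N\<^esub> v"]
        quotient_module_add[OF tensor_free_module tensor_kernel_submodule, of u v]
      by (auto simp: tensor_carrier) (auto simp: tensor_def tensor_free_def)
  next
    case (basis r q)
    obtain m n where q: "q = (m, n)" "m \<in> carrier M" "n \<in> carrier N" using basis by auto
    have "tensor_kernel k M N +>\<^bsub>tensor_free k M N\<^esub> (r \<odot>\<^bsub>tensor_free k M N\<^esub> basis_elem k q) =
        r \<odot>\<^bsub>tensor k M N\<^esub> pure_tensor k M N m n"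
      using quotient_module_smult[OF tensor_free_module tensor_kernel_submodule basis(1)] q
      by (simp add: tensor_def pure_tensor_def tensor_free_basis_closed)
    also have "\<dots> = pure_tensor k M N (r \<odot>\<^bsub>M\<^esub> m) n"
      using q basis by (simp add: pt.smult_left)
    finally show ?case using pure q basis by (simp add: tensor_free_def)
  qed
qed

lemma tensor_linear_maps_agree:
  assumes P: "module k P"
    and f: "f \<in> linear_maps k (tensor k M N) P" and g: "g \<in> linear_maps k (tensor k M N) P"
    and eq: "\<And>m n. \<lbrakk>m \<in> carrier M; n \<in> carrier N\<rbrakk> \<Longrightarrow>
      f (pure_tensor k M N m n) = g (pure_tensor k M N m n)"
  shows "f = g"
proof (rule linear_maps_eqI[OF f g])
  fix t assume "t \<in> carrier (tensor k M N)"
  then show "f t = g t"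
    by (induction rule: tensor_induct)
      (simp_all add: linear_maps_zero[OF f tensor_module P] linear_maps_zero[OF g tensor_module P]
        linear_maps_add[OF f] linear_maps_add[OF g] eq)
qed

context
  fixes P :: "('k, 'p) module" and b :: "'m \<Rightarrow> 'n \<Rightarrow> 'p"
  assumes P: "module k P" and b: "bilinear_map k M N P b"
begin

interpretation P: module k P by (rule P)
interpretation b: bilinear_map k M N P b by (rule b)

private definition \<phi> where
  "\<phi> = restrict (free_lift k P (\<lambda>q. b (fst q) (snd q))) (carrier (tensor_free k M N))"

private lemma \<phi>_linear: "\<phi> \<in> linear_maps k (tensor_free k M N) P"
  unfolding tensor_free_def \<phi>_def by (rule free_lift_linear[OF P]) (auto simp: b.closed)

private lemma \<phi>_basis:
  assumes "m \<in> carrier M" "n \<in> carrier N"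
  shows "\<phi> (basis_elem k (m, n)) = b m n"
  using assms free_lift_basis[OF P, of "carrier M \<times> carrier N" "\<lambda>q. b (fst q) (snd q)" "(m, n)"]
  by (auto simp: \<phi>_def tensor_free_basis_closed b.closed)

private lemma \<phi>_kernel:
  assumes "u \<in> tensor_kernel k M N"
  shows "\<phi> u = \<zero>\<^bsub>P\<^esub>"
proof -
  define H where "H = {u \<in> carrier (tensor_free k M N). \<phi> u = \<zero>\<^bsub>P\<^esub>}"
  note lin = linear_maps_closed[OF \<phi>_linear] linear_maps_add[OF \<phi>_linear]
    linear_maps_smult[OF \<phi>_linear] linear_maps_zero[OF \<phi>_linear tensor_free_module P]
    linear_maps_a_inv[OF \<phi>_linear tensor_free_module P]
  have "submodule H k (tensor_free k M N)"
    by (rule F.submoduleI) (auto simp: H_def lin)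
  moreover have "tensor_relations k M N \<subseteq> H"
    unfolding H_def tensor_relations_def Let_def
    by (auto simp: tensor_free_basis_closed lin \<phi>_basis b.closed b.add_left b.add_right
        b.smult_left b.smult_right a_minus_def P.r_neg)
  ultimately show ?thesis
    using assms generated_submodule_least unfolding tensor_kernel_def H_def by blast
qed

private lemma tensor_lift_coset:
  assumes u: "u \<in> carrier (tensor_free k M N)"
  shows "tensor_lift k M N P b (tensor_kernel k M N +>\<^bsub>tensor_free k M N\<^esub> u) = \<phi> u"
proof -
  interpret K: abelian_subgroup "tensor_kernel k M N" "tensor_free k M N"
    by (rule submodule_abelian_subgroup[OF tensor_free_module tensor_kernel_submodule])
  let ?t = "tensor_kernel k M N +>\<^bsub>tensor_free k M N\<^esub> u"
  have "free_lift k P (\<lambda>q. b (fst q) (snd q)) v = \<phi> u" if v: "v \<in> ?t" for v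
  proof -
    have vF: "v \<in> carrier (tensor_free k M N)" using K.a_elemrcos_carrier[OF u v] .
    obtain h where h: "h \<in> tensor_kernel k M N" "v = h \<oplus>\<^bsub>tensor_free k M N\<^esub> u"
      using v by (auto simp: a_r_coset_def')
    then have "\<phi> v = \<phi> u"
      using u linear_maps_closed[OF \<phi>_linear u]
      by (simp add: linear_maps_add[OF \<phi>_linear] \<phi>_kernel)
    then show ?thesis using vF by (simp add: \<phi>_def)
  qed
  then have "free_lift k P (\<lambda>q. b (fst q) (snd q)) ` ?t = {\<phi> u}"
    using K.a_rcos_self[OF u] by force
  moreover have "?t \<in> carrier (tensor k M N)" using u by (simp add: tensor_carrier)
  ultimately show ?thesis
    by (simp add: tensor_lift_def free_lift_def[symmetric, abs_def])
qed

lemma tensor_lift_linear: "tensor_lift k M N P b \<in> linear_maps k (tensor k M N) P"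
proof (rule linear_mapsI)
  fix s t assume "s \<in> carrier (tensor k M N)" "t \<in> carrier (tensor k M N)"
  then obtain u v where uv: "u \<in> carrier (tensor_free k M N)" "v \<in> carrier (tensor_free k M N)"
    "s = tensor_kernel k M N +>\<^bsub>tensor_free k M N\<^esub> u" "t = tensor_kernel k M N +>\<^bsub>tensor_free k M N\<^esub> v"
    by (auto simp: tensor_carrier)
  have "s \<oplus>\<^bsub>tensor k M N\<^esub> t = tensor_kernel k M N +>\<^bsub>tensor_free k M N\<^esub> (u \<oplus>\<^bsub>tensor_free k M N\<^esub> v)"
    using uv quotient_module_add[OF tensor_free_module tensor_kernel_submodule]
    by (simp add: tensor_def)
  then show "tensor_lift k M N P b (s \<oplus>\<^bsub>tensor k M N\<^esub> t) = tensor_lift k M N P b s \<oplus>\<^bsub>P\<^esub> tensor_lift k M N P b t"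
    using uv by (simp add: tensor_lift_coset linear_maps_add[OF \<phi>_linear])
next
  fix r t assume r: "r \<in> carrier k" and "t \<in> carrier (tensor k M N)"
  then obtain u where u: "u \<in> carrier (tensor_free k M N)"
    "t = tensor_kernel k M N +>\<^bsub>tensor_free k M N\<^esub> u"
    by (auto simp: tensor_carrier)
  have "r \<odot>\<^bsub>tensor k M N\<^esub> t = tensor_kernel k M N +>\<^bsub>tensor_free k M N\<^esub> (r \<odot>\<^bsub>tensor_free k M N\<^esub> u)"
    using u r quotient_module_smult[OF tensor_free_module tensor_kernel_submodule]
    by (simp add: tensor_def)
  then show "tensor_lift k M N P b (r \<odot>\<^bsub>tensor k M N\<^esub> t) = r \<odot>\<^bsub>P\<^esub> tensor_lift k M N P b t"
    using u r by (simp add: tensor_lift_coset linear_maps_smult[OF \<phi>_linear])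
qed (auto simp: tensor_carrier tensor_lift_coset linear_maps_closed[OF \<phi>_linear],
    simp add: tensor_lift_def tensor_carrier)

lemma tensor_lift_pure:
  "\<lbrakk>m \<in> carrier M; n \<in> carrier N\<rbrakk> \<Longrightarrow> tensor_lift k M N P b (pure_tensor k M N m n) = b m n"
  by (simp add: pure_tensor_def tensor_lift_coset tensor_free_basis_closed \<phi>_basis)

end

lemma tensor_lift_unique:
  assumes P: "module k P" and f: "f \<in> linear_maps k (tensor k M N) P"
    and eq: "\<And>m n. \<lbrakk>m \<in> carrier M; n \<in> carrier N\<rbrakk> \<Longrightarrow> f (pure_tensor k M N m n) = b m n"
  shows "tensor_lift k M N P b = f"
proof -
  interpret pt: bilinear_map k M N "tensor k M N" "pure_tensor k M N"
    by (rule bilinear_map_pure_tensor)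
  have b: "bilinear_map k M N P b"
    by standard
      (simp_all add: eq[symmetric] pt.closed linear_maps_closed[OF f] pt.add_left pt.add_right
        pt.smult_left pt.smult_right linear_maps_add[OF f] linear_maps_smult[OF f])
  show ?thesis
    by (rule tensor_linear_maps_agree[OF P tensor_lift_linear[OF P b] f])
      (simp add: tensor_lift_pure[OF P b] eq)
qed

lemma tensor_lift_addf:
  assumes P: "module k P" and b: "bilinear_map k M N P b" and b': "bilinear_map k M N P b'"
    and c: "bilinear_map k M N P c"
    and eq: "\<And>m n. \<lbrakk>m \<in> carrier M; n \<in> carrier N\<rbrakk> \<Longrightarrow> c m n = b m n \<oplus>\<^bsub>P\<^esub> b' m n"
    and t: "t \<in> carrier (tensor k M N)"
  shows "tensor_lift k M N P c t = tensor_lift k M N P b t \<oplus>\<^bsub>P\<^esub> tensor_lift k M N P b' t"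
proof -
  interpret P: module k P by fact
  note lin = tensor_lift_linear[OF P b] tensor_lift_linear[OF P b'] tensor_lift_linear[OF P c]
  note lins = lin[THEN linear_maps_add] lin[THEN linear_maps_closed]
    lin[THEN linear_maps_zero, OF tensor_module P]
  show ?thesis
    using t by (induction rule: tensor_induct)
      (simp_all add: lins tensor_lift_pure[OF P] b b' c eq P.a_ac)
qed

lemma tensor_lift_smultf:
  assumes P: "module k P" and b: "bilinear_map k M N P b" and c: "bilinear_map k M N P c"
    and r: "r \<in> carrier k"
    and eq: "\<And>m n. \<lbrakk>m \<in> carrier M; n \<in> carrier N\<rbrakk> \<Longrightarrow> c m n = r \<odot>\<^bsub>P\<^esub> b m n"
    and t: "t \<in> carrier (tensor k M N)"
  shows "tensor_lift k M N P c t = r \<odot>\<^bsub>P\<^esub> tensor_lift k M N P b t"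
proof -
  interpret P: module k P by fact
  note lin = tensor_lift_linear[OF P b] tensor_lift_linear[OF P c]
  note lins = lin[THEN linear_maps_add] lin[THEN linear_maps_closed]
    lin[THEN linear_maps_zero, OF tensor_module P]
  show ?thesis
    using t by (induction rule: tensor_induct)
      (simp_all add: lins tensor_lift_pure[OF P] b c eq r P.smult_r_distr)
qed

end

lemma bilinear_map_precomp:
  assumes b: "bilinear_map k P Q R b" and f: "f \<in> linear_maps k M P" and g: "g \<in> linear_maps k N Q"
  shows "bilinear_map k M N R (\<lambda>m n. b (f m) (g n))"
proof -
  interpret b: bilinear_map k P Q R b by fact
  show ?thesis
    by standard
      (simp_all add: linear_maps_closed[OF f] linear_maps_closed[OF g] b.closed b.add_left b.add_right
        b.smult_left b.smult_right linear_maps_add[OF f] linear_maps_add[OF g]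
        linear_maps_smult[OF f] linear_maps_smult[OF g])
qed

context
  fixes k :: "'k ring" and M :: "('k, 'm) module" and N :: "('k, 'n) module"
    and P :: "('k, 'p) module" and Q :: "('k, 'q) module" and f g
  assumes mods: "module k M" "module k N" "module k P" "module k Q"
    and f: "f \<in> linear_maps k M P" and g: "g \<in> linear_maps k N Q"
begin

lemma tensor_map_linear:
  "tensor_map k M N P Q f g \<in> linear_maps k (tensor k M N) (tensor k P Q)"
  unfolding tensor_map_def
  by (intro tensor_lift_linear tensor_module bilinear_map_precomp[OF bilinear_map_pure_tensor] mods f g)

lemma tensor_map_pure:
  assumes "m \<in> carrier M" "n \<in> carrier N"
  shows "tensor_map k M N P Q f g (pure_tensor k M N m n) = pure_tensor k P Q (f m) (g n)"
  unfolding tensor_map_def using assms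
  by (intro tensor_lift_pure tensor_module bilinear_map_precomp[OF bilinear_map_pure_tensor] mods f g)

end

context
  fixes k :: "'k ring" and L :: "('k, 'l) module" and M :: "('k, 'm) module" and N :: "('k, 'n) module"
  assumes L: "module k L" and M: "module k M" and N: "module k N"
begin

interpretation MN: bilinear_map k M N "tensor k M N" "pure_tensor k M N"
  by (rule bilinear_map_pure_tensor[OF M N])
interpretation LMN: bilinear_map k L "tensor k M N" "tensor k L (tensor k M N)"
    "pure_tensor k L (tensor k M N)"
  by (rule bilinear_map_pure_tensor[OF L tensor_module[OF M N]])

private lemma LMN_module: "module k (tensor k L (tensor k M N))"
  by (intro tensor_module L M N)

private lemma assoc_inner:
  assumes "n \<in> carrier N"
  shows "bilinear_map k L M (tensor k L (tensor k M N))
    (\<lambda>l m. pure_tensor k L (tensor k M N) l (pure_tensor k M N m n))"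
  using assms by unfold_locales
    (simp_all add: LMN.closed MN.closed LMN.add_left LMN.add_right MN.add_left LMN.smult_left
      LMN.smult_right MN.smult_left)

private lemma assoc_outer:
  "bilinear_map k (tensor k L M) N (tensor k L (tensor k M N))
    (\<lambda>t n. tensor_lift k L M (tensor k L (tensor k M N))
      (\<lambda>l m. pure_tensor k L (tensor k M N) l (pure_tensor k M N m n)) t)"
proof -
  interpret N: module k N by (rule N)
  note lin = tensor_lift_linear[OF L M LMN_module assoc_inner]
  show ?thesis
  proof
    fix t n n' assume "t \<in> carrier (tensor k L M)" "n \<in> carrier N" "n' \<in> carrier N"
    then show "tensor_lift k L M (tensor k L (tensor k M N))
        (\<lambda>l m. pure_tensor k L (tensor k M N) l (pure_tensor k M N m (n \<oplus>\<^bsub>N\<^esub> n'))) t =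
      tensor_lift k L M (tensor k L (tensor k M N))
        (\<lambda>l m. pure_tensor k L (tensor k M N) l (pure_tensor k M N m n)) t
      \<oplus>\<^bsub>tensor k L (tensor k M N)\<^esub> tensor_lift k L M (tensor k L (tensor k M N))
        (\<lambda>l m. pure_tensor k L (tensor k M N) l (pure_tensor k M N m n')) t"
      by (intro tensor_lift_addf[OF L M LMN_module assoc_inner assoc_inner assoc_inner])
        (simp_all add: MN.add_right LMN.add_right MN.closed)
  next
    fix r t n assume "r \<in> carrier k" "t \<in> carrier (tensor k L M)" "n \<in> carrier N"
    then show "tensor_lift k L M (tensor k L (tensor k M N))
        (\<lambda>l m. pure_tensor k L (tensor k M N) l (pure_tensor k M N m (r \<odot>\<^bsub>N\<^esub> n))) t =
      r \<odot>\<^bsub>tensor k L (tensor k M N)\<^esub> tensor_lift k L M (tensor k L (tensor k M N))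
        (\<lambda>l m. pure_tensor k L (tensor k M N) l (pure_tensor k M N m n)) t"
      by (intro tensor_lift_smultf[OF L M LMN_module assoc_inner assoc_inner])
        (simp_all add: MN.smult_right LMN.smult_right MN.closed)
  qed (simp_all add: linear_maps_closed[OF lin] linear_maps_add[OF lin] linear_maps_smult[OF lin])
qed

lemma tensor_assoc_linear:
  "tensor_assoc k L M N \<in> linear_maps k (tensor k (tensor k L M) N) (tensor k L (tensor k M N))"
  unfolding tensor_assoc_def
  by (intro tensor_lift_linear tensor_module L M N LMN_module assoc_outer)

lemma tensor_assoc_pure:
  assumes "l \<in> carrier L" "m \<in> carrier M" "n \<in> carrier N"
  shows "tensor_assoc k L M N (pure_tensor k (tensor k L M) N (pure_tensor k L M l m) n) =
    pure_tensor k L (tensor k M N) l (pure_tensor k M N m n)"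
  unfolding tensor_assoc_def using assms
  by (simp add: tensor_lift_pure[OF tensor_module[OF L M] N LMN_module assoc_outer]
      bilinear_map.closed[OF bilinear_map_pure_tensor[OF L M]]
      tensor_lift_pure[OF L M LMN_module assoc_inner])

end


section \<open>Duals, contractions and dual bases\<close>

lemma ring_module_simps [simp]:
  "carrier (ring_module k) = carrier k"
  "\<zero>\<^bsub>ring_module k\<^esub> = \<zero>\<^bsub>k\<^esub>"
  "r \<oplus>\<^bsub>ring_module k\<^esub> s = r \<oplus>\<^bsub>k\<^esub> s"
  "r \<odot>\<^bsub>ring_module k\<^esub> s = r \<otimes>\<^bsub>k\<^esub> s"
  by (simp_all add: ring_module_def)

lemma ring_module_module:
  fixes k (structure)
  assumes "cring k"
  shows "module k (ring_module k)"
proof -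
  interpret cring k by fact
  show ?thesis
  proof (rule moduleI)
    show "abelian_group (ring_module k)"
      by (rule abelian_groupI) (auto simp: a_ac intro: l_neg)
  qed (auto simp: l_distr r_distr m_assoc cring_axioms)
qed

lemma dual_module_simps:
  "carrier (dual_module k M) = linear_maps k M (ring_module k)"
  "\<zero>\<^bsub>dual_module k M\<^esub> = (\<lambda>c\<in>carrier M. \<zero>\<^bsub>k\<^esub>)"
  "a \<oplus>\<^bsub>dual_module k M\<^esub> b = (\<lambda>c\<in>carrier M. a c \<oplus>\<^bsub>k\<^esub> b c)"
  "r \<odot>\<^bsub>dual_module k M\<^esub> a = (\<lambda>c\<in>carrier M. r \<otimes>\<^bsub>k\<^esub> a c)"
  by (simp_all add: dual_module_def)

lemma dual_module_apply:
  assumes "c \<in> carrier M"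
  shows "\<zero>\<^bsub>dual_module k M\<^esub> c = \<zero>\<^bsub>k\<^esub>"
    "(a \<oplus>\<^bsub>dual_module k M\<^esub> b) c = a c \<oplus>\<^bsub>k\<^esub> b c"
    "(r \<odot>\<^bsub>dual_module k M\<^esub> a) c = r \<otimes>\<^bsub>k\<^esub> a c"
  using assms by (simp_all add: dual_module_simps)

lemma dual_module_closed:
  "\<lbrakk>a \<in> carrier (dual_module k M); c \<in> carrier M\<rbrakk> \<Longrightarrow> a c \<in> carrier k"
  using linear_maps_closed[of a k M "ring_module k" c] by (simp add: dual_module_simps)

lemma dual_module_add:
  "\<lbrakk>a \<in> carrier (dual_module k M); c \<in> carrier M; d \<in> carrier M\<rbrakk> \<Longrightarrow>
    a (c \<oplus>\<^bsub>M\<^esub> d) = a c \<oplus>\<^bsub>k\<^esub> a d"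
  using linear_maps_add[of a k M "ring_module k" c] by (simp add: dual_module_simps)

lemma dual_module_smult:
  "\<lbrakk>a \<in> carrier (dual_module k M); r \<in> carrier k; c \<in> carrier M\<rbrakk> \<Longrightarrow>
    a (r \<odot>\<^bsub>M\<^esub> c) = r \<otimes>\<^bsub>k\<^esub> a c"
  using linear_maps_smult[of a k M "ring_module k" r c] by (simp add: dual_module_simps)

lemma dual_module_eqI:
  assumes "a \<in> carrier (dual_module k M)" "b \<in> carrier (dual_module k M)"
    and "\<And>c. c \<in> carrier M \<Longrightarrow> a c = b c"
  shows "a = b"
  using assms by (intro linear_maps_eqI[of a k M "ring_module k"]) (simp_all add: dual_module_simps)

lemma dual_module_module:
  fixes k (structure)
  assumes M: "module k M"
  shows "module k (dual_module k M)"
proof -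
  interpret M: module k M by fact
  note cl = dual_module_closed[where k = k and M = M]
  have add_closed: "a \<oplus>\<^bsub>dual_module k M\<^esub> b \<in> carrier (dual_module k M)"
    if "a \<in> carrier (dual_module k M)" "b \<in> carrier (dual_module k M)" for a b
    unfolding dual_module_simps using that
    by (intro linear_maps_restrictI[OF M])
      (auto simp: cl dual_module_add[OF that(1)] dual_module_add[OF that(2)]
        dual_module_smult[OF that(1)] dual_module_smult[OF that(2)] M.R.a_ac M.R.r_distr)
  have smult_closed: "r \<odot>\<^bsub>dual_module k M\<^esub> a \<in> carrier (dual_module k M)"
    if "r \<in> carrier k" "a \<in> carrier (dual_module k M)" for r a
    unfolding dual_module_simps using that
    by (intro linear_maps_restrictI[OF M])
      (auto simp: cl dual_module_add[OF that(2)] dual_module_smult[OF that(2)] M.R.m_ac M.R.r_distr)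
  have zero_closed: "\<zero>\<^bsub>dual_module k M\<^esub> \<in> carrier (dual_module k M)"
    unfolding dual_module_simps by (intro linear_maps_restrictI[OF M]) auto
  show ?thesis
  proof (rule moduleI)
    show "abelian_group (dual_module k M)"
    proof (rule abelian_groupI)
      fix a assume a: "a \<in> carrier (dual_module k M)"
      show "\<exists>b\<in>carrier (dual_module k M). b \<oplus>\<^bsub>dual_module k M\<^esub> a = \<zero>\<^bsub>dual_module k M\<^esub>"
      proof
        show "(\<ominus> \<one>) \<odot>\<^bsub>dual_module k M\<^esub> a \<in> carrier (dual_module k M)"
          using a by (simp add: smult_closed)
        then show "(\<ominus> \<one>) \<odot>\<^bsub>dual_module k M\<^esub> a \<oplus>\<^bsub>dual_module k M\<^esub> a = \<zero>\<^bsub>dual_module k M\<^esub>"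
          using a zero_closed add_closed
            by (auto intro!: dual_module_eqI[where k = k and M = M]
              simp: dual_module_apply cl M.R.l_minus M.R.l_neg)
      qed
    qed (use add_closed zero_closed in
        \<open>auto intro!: dual_module_eqI[where k = k and M = M] simp: dual_module_apply cl M.R.a_ac\<close>)
  qed (use add_closed zero_closed smult_closed in
      \<open>auto intro!: dual_module_eqI[where k = k and M = M]
        simp: dual_module_apply cl M.R.l_distr M.R.r_distr M.R.m_assoc M.R.cring_axioms\<close>)
qed

lemma linear_maps_finsum_pointwise:
  assumes M: "module k M" and N: "module k N" and I: "finite I"
    and F: "\<And>i. i \<in> I \<Longrightarrow> F i \<in> linear_maps k M N"
  shows "(\<lambda>t\<in>carrier M. \<Oplus>\<^bsub>N\<^esub>i\<in>I. F i t) \<in> linear_maps k M N"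
proof -
  interpret N: module k N by fact
  interpret M: module k M by fact
  note cl = linear_maps_closed[OF F]
  show ?thesis
  proof (rule linear_maps_restrictI[OF M])
    fix s t assume st: "s \<in> carrier M" "t \<in> carrier M"
    have "(\<Oplus>\<^bsub>N\<^esub>i\<in>I. F i (s \<oplus>\<^bsub>M\<^esub> t)) = (\<Oplus>\<^bsub>N\<^esub>i\<in>I. F i s \<oplus>\<^bsub>N\<^esub> F i t)"
      using st by (intro N.finsum_cong') (auto simp: cl linear_maps_add[OF F])
    also have "\<dots> = (\<Oplus>\<^bsub>N\<^esub>i\<in>I. F i s) \<oplus>\<^bsub>N\<^esub> (\<Oplus>\<^bsub>N\<^esub>i\<in>I. F i t)"
      using st by (intro N.finsum_addf) (auto simp: cl)
    finally show "(\<Oplus>\<^bsub>N\<^esub>i\<in>I. F i (s \<oplus>\<^bsub>M\<^esub> t)) = (\<Oplus>\<^bsub>N\<^esub>i\<in>I. F i s) \<oplus>\<^bsub>N\<^esub> (\<Oplus>\<^bsub>N\<^esub>i\<in>I. F i t)" .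
  next
    fix r t assume rt: "r \<in> carrier k" "t \<in> carrier M"
    have "(\<Oplus>\<^bsub>N\<^esub>i\<in>I. F i (r \<odot>\<^bsub>M\<^esub> t)) = (\<Oplus>\<^bsub>N\<^esub>i\<in>I. r \<odot>\<^bsub>N\<^esub> F i t)"
      using rt by (intro N.finsum_cong') (auto simp: cl linear_maps_smult[OF F])
    also have "\<dots> = r \<odot>\<^bsub>N\<^esub> (\<Oplus>\<^bsub>N\<^esub>i\<in>I. F i t)"
      using rt I by (intro N.finsum_smult_ldistr[symmetric]) (auto simp: cl)
    finally show "(\<Oplus>\<^bsub>N\<^esub>i\<in>I. F i (r \<odot>\<^bsub>M\<^esub> t)) = r \<odot>\<^bsub>N\<^esub> (\<Oplus>\<^bsub>N\<^esub>i\<in>I. F i t)" .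
  qed (auto simp: cl)
qed

lemma (in abelian_group) finsum_Times:
  assumes "finite A" "finite B" "f \<in> A \<times> B \<rightarrow> carrier G"
  shows "finsum G f (A \<times> B) = (\<Oplus>i\<in>A. \<Oplus>j\<in>B. f (i, j))"
  using assms(1,3)
proof (induction A rule: finite_induct)
  case (insert x A)
  have eq: "insert x A \<times> B = Pair x ` B \<union> A \<times> B" by auto
  have "finsum G f (insert x A \<times> B) = finsum G f (Pair x ` B) \<oplus> finsum G f (A \<times> B)"
    unfolding eq using insert assms(2) by (intro finsum_Un_disjoint) auto
  also have "finsum G f (Pair x ` B) = (\<Oplus>j\<in>B. f (x, j))"
    using insert by (intro finsum_reindex) (auto simp: inj_on_def)
  also have "finsum G f (A \<times> B) = (\<Oplus>i\<in>A. \<Oplus>j\<in>B. f (i, j))"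
    using insert by auto
  also have "(\<Oplus>j\<in>B. f (x, j)) \<oplus> (\<Oplus>i\<in>A. \<Oplus>j\<in>B. f (i, j)) = (\<Oplus>i\<in>insert x A. \<Oplus>j\<in>B. f (i, j))"
    using insert by (intro finsum_insert[symmetric]) (auto intro!: finsum_closed)
  finally show ?case .
qed simp

definition dual_basis :: "'k ring \<Rightarrow> ('k, 'm) module \<Rightarrow> 'i set \<Rightarrow> ('i \<Rightarrow> 'm \<Rightarrow> 'k) \<Rightarrow> ('i \<Rightarrow> 'm) \<Rightarrow> bool" where
  "dual_basis k M I a c \<longleftrightarrow> finite I \<and> a \<in> I \<rightarrow> carrier (dual_module k M) \<and> c \<in> I \<rightarrow> carrier M \<and>
     (\<forall>y\<in>carrier M. (\<Oplus>\<^bsub>M\<^esub>i\<in>I. a i y \<odot>\<^bsub>M\<^esub> c i) = y)"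

lemma dual_basisD:
  assumes "dual_basis k M I a c"
  shows "finite I" "i \<in> I \<Longrightarrow> a i \<in> carrier (dual_module k M)" "i \<in> I \<Longrightarrow> c i \<in> carrier M"
    "y \<in> carrier M \<Longrightarrow> (\<Oplus>\<^bsub>M\<^esub>i\<in>I. a i y \<odot>\<^bsub>M\<^esub> c i) = y"
  using assms by (auto simp: dual_basis_def)

theorem finitely_generated_projective_dual_basis:
  fixes P :: "('k, 'm) module"
  assumes P: "module k P" and fg: "finitely_generated k P" and proj: "projective k P"
  shows "\<exists>(I :: 'm set) a c. dual_basis k P I a c"
proof -
  interpret P: module k P by fact
  obtain S where S: "finite S" "S \<subseteq> carrier P" "generated_submodule k P S = carrier P"
    using fg by (auto simp: finitely_generated_def)
  obtain B :: "'m set" and s p where s: "s \<in> linear_maps k P (free_module k B)"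
    and p: "p \<in> linear_maps k (free_module k B) P" and ps: "\<And>y. y \<in> carrier P \<Longrightarrow> p (s y) = y"
    using proj by (auto simp: projective_def)
  interpret F: module k "free_module k B" by (rule free_module_module[OF P.R.cring_axioms])
  note s_lin = linear_maps_add[OF s] linear_maps_smult[OF s] linear_maps_zero[OF s P F.module_axioms]
  define I where "I = (\<Union>x\<in>S. supp k (s x))"
  have sF: "range (s y) \<subseteq> carrier k" "finite (supp k (s y))" "supp k (s y) \<subseteq> B" if "y \<in> carrier P" for y
    using linear_maps_closed[OF s that] by (auto simp: free_module_simps)
  then have scl: "s y b \<in> carrier k" if "y \<in> carrier P" for y b using that by auto
  have I: "finite I" "I \<subseteq> B" unfolding I_def using S(1,2) sF by blast+
  define H where "H = {y \<in> carrier P. \<forall>b. b \<notin> I \<longrightarrow> s y b = \<zero>\<^bsub>k\<^esub>}"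
  have "submodule H k P"
  proof (rule P.submoduleI)
    fix y assume "y \<in> H"
    then have y: "y \<in> carrier P" "\<And>b. b \<notin> I \<Longrightarrow> s y b = \<zero>\<^bsub>k\<^esub>" by (auto simp: H_def)
    have "\<ominus>\<^bsub>P\<^esub> y = (\<ominus>\<^bsub>k\<^esub> \<one>\<^bsub>k\<^esub>) \<odot>\<^bsub>P\<^esub> y"
      using y by (simp add: P.smult_l_minus)
    then have "s (\<ominus>\<^bsub>P\<^esub> y) = (\<lambda>b. (\<ominus>\<^bsub>k\<^esub> \<one>\<^bsub>k\<^esub>) \<otimes>\<^bsub>k\<^esub> s y b)"
      using y by (simp add: s_lin free_module_simps)
    then show "\<ominus>\<^bsub>P\<^esub> y \<in> H" using y by (auto simp: H_def)
  qed (auto simp: H_def s_lin free_module_simps)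
  moreover have "S \<subseteq> H" using S(2) by (auto simp: H_def I_def supp_def)
  ultimately have H: "supp k (s y) \<subseteq> I" if "y \<in> carrier P" for y
    using generated_submodule_least[of H k P S] S(3) that by (auto simp: H_def supp_def)
  define a where "a = (\<lambda>b. \<lambda>y\<in>carrier P. s y b)"
  define c where "c = (\<lambda>b. p (basis_elem k b))"
  have cP: "c b \<in> carrier P" if "b \<in> B" for b
    unfolding c_def using that by (intro linear_maps_closed[OF p] basis_elem_closed P.R.cring_axioms)
  have a: "a b \<in> carrier (dual_module k P)" for b
    unfolding a_def dual_module_simps
    by (intro linear_maps_restrictI[OF P]) (auto simp: scl s_lin free_module_simps)
  have "(\<Oplus>\<^bsub>P\<^esub>b\<in>I. a b y \<odot>\<^bsub>P\<^esub> c b) = y" if y: "y \<in> carrier P" for y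
  proof -
    have "(\<Oplus>\<^bsub>P\<^esub>b\<in>I. a b y \<odot>\<^bsub>P\<^esub> c b) = (\<Oplus>\<^bsub>P\<^esub>b\<in>I. s y b \<odot>\<^bsub>P\<^esub> c b)"
      using y by (simp add: a_def)
    also have "\<dots> = free_lift k P c (s y)"
      by (rule free_lift_superset[OF P cP linear_maps_closed[OF s y] I(1) H[OF y] I(2), symmetric])
    also have "\<dots> = (\<lambda>u\<in>carrier (free_module k B). free_lift k P c u) (s y)"
      using linear_maps_closed[OF s y] by simp
    also have "\<dots> = p (s y)"
      by (rule free_module_linear_maps_agree[OF P.R.cring_axioms P free_lift_linear[OF P cP] p
            _ linear_maps_closed[OF s y]])
        (simp_all add: basis_elem_closed P.R.cring_axioms free_lift_basis[OF P cP], simp add: c_def)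
    also have "\<dots> = y" by (rule ps[OF y])
    finally show ?thesis .
  qed
  then have "dual_basis k P I a c" using I a cP by (auto simp: dual_basis_def)
  then show ?thesis by blast
qed

definition contract :: "'k ring \<Rightarrow> ('k, 'm) module \<Rightarrow> ('k, 'c) module \<Rightarrow> ('c \<Rightarrow> 'k) \<Rightarrow>
    ('m \<times> 'c \<Rightarrow> 'k) set \<Rightarrow> 'm" where
  "contract k M C a = tensor_lift k M C M (\<lambda>m c. a c \<odot>\<^bsub>M\<^esub> m)"

definition tensor_functional :: "'k ring \<Rightarrow> ('k, 'c) module \<Rightarrow> ('k, 'd) module \<Rightarrow> ('c \<Rightarrow> 'k) \<Rightarrow>
    ('d \<Rightarrow> 'k) \<Rightarrow> ('c \<times> 'd \<Rightarrow> 'k) set \<Rightarrow> 'k" where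
  "tensor_functional k C D b a = tensor_lift k C D (ring_module k) (\<lambda>c d. a d \<otimes>\<^bsub>k\<^esub> b c)"

context
  fixes k :: "'k ring" and M :: "('k, 'm) module" and C :: "('k, 'c) module"
  assumes M: "module k M" and C: "module k C"
begin

interpretation M: module k M by (rule M)
interpretation C: module k C by (rule C)
interpretation MC: module k "tensor k M C" by (rule tensor_module[OF M C])
interpretation pt: bilinear_map k M C "tensor k M C" "pure_tensor k M C"
  by (rule bilinear_map_pure_tensor[OF M C])

lemma contract_bilinear:
  assumes "a \<in> carrier (dual_module k C)"
  shows "bilinear_map k M C M (\<lambda>m c. a c \<odot>\<^bsub>M\<^esub> m)"
  using assms
  by unfold_locales
    (simp_all add: dual_module_closed[OF assms] dual_module_add[OF assms] dual_module_smult[OF assms]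
      M.smult_l_distr M.smult_r_distr M.smult_assoc1[symmetric] M.R.m_comm)

lemma contract_linear:
  "a \<in> carrier (dual_module k C) \<Longrightarrow> contract k M C a \<in> linear_maps k (tensor k M C) M"
  unfolding contract_def by (rule tensor_lift_linear[OF M C M contract_bilinear])

lemma contract_pure:
  "\<lbrakk>a \<in> carrier (dual_module k C); m \<in> carrier M; c \<in> carrier C\<rbrakk> \<Longrightarrow>
    contract k M C a (pure_tensor k M C m c) = a c \<odot>\<^bsub>M\<^esub> m"
  unfolding contract_def by (rule tensor_lift_pure[OF M C M contract_bilinear])

lemma contract_addf:
  assumes "a \<in> carrier (dual_module k C)" "b \<in> carrier (dual_module k C)" "t \<in> carrier (tensor k M C)"
  shows "contract k M C (a \<oplus>\<^bsub>dual_module k C\<^esub> b) t = contract k M C a t \<oplus>\<^bsub>M\<^esub> contract k M C b t"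
proof -
  interpret A: module k "dual_module k C" by (rule dual_module_module[OF C])
  show ?thesis
    unfolding contract_def using assms
    by (intro tensor_lift_addf[OF M C M] contract_bilinear)
      (auto simp: dual_module_apply M.smult_l_distr dual_module_closed)
qed

lemma contract_smultf:
  assumes "r \<in> carrier k" "a \<in> carrier (dual_module k C)" "t \<in> carrier (tensor k M C)"
  shows "contract k M C (r \<odot>\<^bsub>dual_module k C\<^esub> a) t = r \<odot>\<^bsub>M\<^esub> contract k M C a t"
proof -
  interpret A: module k "dual_module k C" by (rule dual_module_module[OF C])
  show ?thesis
    unfolding contract_def using assms
    by (intro tensor_lift_smultf[OF M C M] contract_bilinear)
      (auto simp: dual_module_apply M.smult_assoc1 dual_module_closed)
qed

lemma pure_tensor_linear_right:
  "m \<in> carrier M \<Longrightarrow> (\<lambda>c\<in>carrier C. pure_tensor k M C m c) \<in> linear_maps k C (tensor k M C)"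
  by (intro linear_maps_restrictI[OF C]) (simp_all add: pt.closed pt.add_right pt.smult_right)

lemma pure_tensor_linear_left:
  "c \<in> carrier C \<Longrightarrow> (\<lambda>m\<in>carrier M. pure_tensor k M C m c) \<in> linear_maps k M (tensor k M C)"
  by (intro linear_maps_restrictI[OF M]) (simp_all add: pt.closed pt.add_left pt.smult_left)

lemma pure_tensor_finsum_right:
  assumes "m \<in> carrier M" "finite I" "f \<in> I \<rightarrow> carrier C"
  shows "pure_tensor k M C m (\<Oplus>\<^bsub>C\<^esub>i\<in>I. f i) = (\<Oplus>\<^bsub>tensor k M C\<^esub>i\<in>I. pure_tensor k M C m (f i))"
proof -
  have "pure_tensor k M C m (\<Oplus>\<^bsub>C\<^esub>i\<in>I. f i) =
      (\<Oplus>\<^bsub>tensor k M C\<^esub>i\<in>I. (\<lambda>c\<in>carrier C. pure_tensor k M C m c) (f i))"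
    using linear_maps_finsum[OF pure_tensor_linear_right[OF assms(1)] C MC.module_axioms assms(2,3)]
      C.finsum_closed[OF assms(3)] by simp
  also have "\<dots> = (\<Oplus>\<^bsub>tensor k M C\<^esub>i\<in>I. pure_tensor k M C m (f i))"
    using assms by (intro MC.finsum_cong') (auto simp: pt.closed Pi_iff)
  finally show ?thesis .
qed

lemma pure_tensor_finsum_left:
  assumes "c \<in> carrier C" "finite I" "f \<in> I \<rightarrow> carrier M"
  shows "pure_tensor k M C (\<Oplus>\<^bsub>M\<^esub>i\<in>I. f i) c = (\<Oplus>\<^bsub>tensor k M C\<^esub>i\<in>I. pure_tensor k M C (f i) c)"
proof -
  have "pure_tensor k M C (\<Oplus>\<^bsub>M\<^esub>i\<in>I. f i) c =
      (\<Oplus>\<^bsub>tensor k M C\<^esub>i\<in>I. (\<lambda>m\<in>carrier M. pure_tensor k M C m c) (f i))"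
    using linear_maps_finsum[OF pure_tensor_linear_left[OF assms(1)] M MC.module_axioms assms(2,3)]
      M.finsum_closed[OF assms(3)] by simp
  also have "\<dots> = (\<Oplus>\<^bsub>tensor k M C\<^esub>i\<in>I. pure_tensor k M C (f i) c)"
    using assms by (intro MC.finsum_cong') (auto simp: pt.closed Pi_iff)
  finally show ?thesis .
qed

lemma tensor_functional_bilinear:
  assumes b: "b \<in> carrier (dual_module k M)" and a: "a \<in> carrier (dual_module k C)"
  shows "bilinear_map k M C (ring_module k) (\<lambda>c d. a d \<otimes>\<^bsub>k\<^esub> b c)"
  by unfold_locales
    (simp_all add: dual_module_closed[OF a] dual_module_closed[OF b] dual_module_add[OF a]
      dual_module_add[OF b] dual_module_smult[OF a] dual_module_smult[OF b]
      M.R.l_distr M.R.r_distr M.R.m_ac)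

lemma tensor_functional_closed:
  assumes "b \<in> carrier (dual_module k M)" "a \<in> carrier (dual_module k C)"
  shows "tensor_functional k M C b a \<in> carrier (dual_module k (tensor k M C))"
  unfolding tensor_functional_def dual_module_simps
  by (intro tensor_lift_linear M C ring_module_module M.R.cring_axioms tensor_functional_bilinear assms)

lemma tensor_functional_pure:
  assumes "b \<in> carrier (dual_module k M)" "a \<in> carrier (dual_module k C)"
    "m \<in> carrier M" "c \<in> carrier C"
  shows "tensor_functional k M C b a (pure_tensor k M C m c) = a c \<otimes>\<^bsub>k\<^esub> b m"
  unfolding tensor_functional_def
  by (intro tensor_lift_pure M C ring_module_module M.R.cring_axioms tensor_functional_bilinear assms)

lemma tensor_dual_basis:
  assumes b: "dual_basis k M I b x" and a: "dual_basis k C J a c"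
  shows "dual_basis k (tensor k M C) (I \<times> J) (\<lambda>(i, j). tensor_functional k M C (b i) (a j))
    (\<lambda>(i, j). pure_tensor k M C (x i) (c j))"
proof -
  note bD = dual_basisD[OF b] and aD = dual_basisD[OF a]
  note mem = bD(2,3) aD(2,3) pt.closed tensor_functional_closed
  define g where "g = (\<lambda>t\<in>carrier (tensor k M C). \<Oplus>\<^bsub>tensor k M C\<^esub>p\<in>I \<times> J.
      tensor_functional k M C (b (fst p)) (a (snd p)) t \<odot>\<^bsub>tensor k M C\<^esub>
        pure_tensor k M C (x (fst p)) (c (snd p)))"
  have g': "g = (\<lambda>t\<in>carrier (tensor k M C). \<Oplus>\<^bsub>tensor k M C\<^esub>p\<in>I \<times> J.
      (\<lambda>t\<in>carrier (tensor k M C). tensor_functional k M C (b (fst p)) (a (snd p)) t \<odot>\<^bsub>tensor k M C\<^esub>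
        pure_tensor k M C (x (fst p)) (c (snd p))) t)"
    by (simp add: g_def cong: restrict_cong)
  have g: "g \<in> linear_maps k (tensor k M C) (tensor k M C)"
    unfolding g'
  proof (rule linear_maps_finsum_pointwise)
    fix p assume p: "p \<in> I \<times> J"
    then have tf: "tensor_functional k M C (b (fst p)) (a (snd p)) \<in> carrier (dual_module k (tensor k M C))"
      and q: "pure_tensor k M C (x (fst p)) (c (snd p)) \<in> carrier (tensor k M C)"
      by (auto simp: mem)
    show "(\<lambda>t\<in>carrier (tensor k M C). tensor_functional k M C (b (fst p)) (a (snd p)) t \<odot>\<^bsub>tensor k M C\<^esub>
        pure_tensor k M C (x (fst p)) (c (snd p))) \<in> linear_maps k (tensor k M C) (tensor k M C)"
      by (rule linear_maps_restrictI[OF MC.module_axioms])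
        (simp_all add: dual_module_closed[OF tf] dual_module_add[OF tf] dual_module_smult[OF tf] q
          MC.smult_l_distr MC.smult_assoc1)
  qed (use bD(1) aD(1) MC.module_axioms in auto)
  have "g = id_map (tensor k M C)"
  proof (rule tensor_linear_maps_agree[OF M C MC.module_axioms g id_map_linear[OF MC.module_axioms]])
    fix m d assume md: "m \<in> carrier M" "d \<in> carrier C"
    note cl = dual_module_closed[OF bD(2) md(1)] dual_module_closed[OF aD(2) md(2)]
    have "g (pure_tensor k M C m d) = (\<Oplus>\<^bsub>tensor k M C\<^esub>p\<in>I \<times> J.
        pure_tensor k M C (b (fst p) m \<odot>\<^bsub>M\<^esub> x (fst p)) (a (snd p) d \<odot>\<^bsub>C\<^esub> c (snd p)))"
      unfolding g_def using md
      by (simp add: pt.closed, intro MC.finsum_cong')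
        (auto simp: mem cl tensor_functional_pure pt.smult_left pt.smult_right MC.smult_assoc1[symmetric] M.R.m_comm)
    also have "\<dots> = (\<Oplus>\<^bsub>tensor k M C\<^esub>i\<in>I. \<Oplus>\<^bsub>tensor k M C\<^esub>j\<in>J.
        pure_tensor k M C (b i m \<odot>\<^bsub>M\<^esub> x i) (a j d \<odot>\<^bsub>C\<^esub> c j))"
      using bD(1) aD(1) by (subst MC.finsum_Times) (auto simp: mem cl)
    also have "\<dots> = (\<Oplus>\<^bsub>tensor k M C\<^esub>i\<in>I. pure_tensor k M C (b i m \<odot>\<^bsub>M\<^esub> x i) d)"
    proof (rule MC.finsum_cong')
      fix i assume i: "i \<in> I"
      have "(\<Oplus>\<^bsub>tensor k M C\<^esub>j\<in>J. pure_tensor k M C (b i m \<odot>\<^bsub>M\<^esub> x i) (a j d \<odot>\<^bsub>C\<^esub> c j)) =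
          pure_tensor k M C (b i m \<odot>\<^bsub>M\<^esub> x i) (\<Oplus>\<^bsub>C\<^esub>j\<in>J. a j d \<odot>\<^bsub>C\<^esub> c j)"
        using i aD(1) by (intro pure_tensor_finsum_right[symmetric]) (auto simp: mem cl)
      then show "(\<Oplus>\<^bsub>tensor k M C\<^esub>j\<in>J. pure_tensor k M C (b i m \<odot>\<^bsub>M\<^esub> x i) (a j d \<odot>\<^bsub>C\<^esub> c j)) =
          pure_tensor k M C (b i m \<odot>\<^bsub>M\<^esub> x i) d"
        by (simp add: aD(4)[OF md(2)])
    qed (auto simp: mem cl md)
    also have "\<dots> = pure_tensor k M C (\<Oplus>\<^bsub>M\<^esub>i\<in>I. b i m \<odot>\<^bsub>M\<^esub> x i) d"
      using bD(1) md by (intro pure_tensor_finsum_left[symmetric]) (auto simp: mem cl)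
    also have "\<dots> = pure_tensor k M C m d" by (simp add: bD(4)[OF md(1)])
    finally show "g (pure_tensor k M C m d) = id_map (tensor k M C) (pure_tensor k M C m d)"
      using md by (simp add: pt.closed)
  qed
  then have "g t = t" if "t \<in> carrier (tensor k M C)" for t using that by simp
  then show ?thesis
    using bD(1) aD(1) by (auto simp: dual_basis_def g_def split_beta mem)
qed

lemma tensor_expand:
  assumes a: "dual_basis k C I a c" and t: "t \<in> carrier (tensor k M C)"
  shows "(\<Oplus>\<^bsub>tensor k M C\<^esub>i\<in>I. pure_tensor k M C (contract k M C (a i) t) (c i)) = t"
proof -
  note aD = dual_basisD[OF a]
  define g where "g = (\<lambda>t\<in>carrier (tensor k M C). \<Oplus>\<^bsub>tensor k M C\<^esub>i\<in>I.
      pure_tensor k M C (contract k M C (a i) t) (c i))"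
  have g': "g = (\<lambda>t\<in>carrier (tensor k M C). \<Oplus>\<^bsub>tensor k M C\<^esub>i\<in>I.
      (\<lambda>t\<in>carrier (tensor k M C). pure_tensor k M C (contract k M C (a i) t) (c i)) t)"
    by (simp add: g_def cong: restrict_cong)
  have g: "g \<in> linear_maps k (tensor k M C) (tensor k M C)"
    unfolding g'
  proof (rule linear_maps_finsum_pointwise)
    fix i assume "i \<in> I"
    then have i: "contract k M C (a i) \<in> linear_maps k (tensor k M C) M" "c i \<in> carrier C"
      using aD(2,3) by (auto simp: contract_linear)
    show "(\<lambda>t\<in>carrier (tensor k M C). pure_tensor k M C (contract k M C (a i) t) (c i))
        \<in> linear_maps k (tensor k M C) (tensor k M C)"
      by (rule linear_maps_restrictI[OF MC.module_axioms])
        (simp_all add: linear_maps_closed[OF i(1)] linear_maps_add[OF i(1)] linear_maps_smult[OF i(1)]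
          i(2) pt.closed pt.add_left pt.smult_left)
  qed (use aD(1) MC.module_axioms in auto)
  have "g = id_map (tensor k M C)"
  proof (rule tensor_linear_maps_agree[OF M C MC.module_axioms g id_map_linear[OF MC.module_axioms]])
    fix m d assume md: "m \<in> carrier M" "d \<in> carrier C"
    note cl = dual_module_closed[OF aD(2) md(2)]
    have "g (pure_tensor k M C m d) = (\<Oplus>\<^bsub>tensor k M C\<^esub>i\<in>I. pure_tensor k M C m (a i d \<odot>\<^bsub>C\<^esub> c i))"
      unfolding g_def using md
      by (simp add: pt.closed, intro MC.finsum_cong')
        (auto simp: aD(2,3) cl contract_pure pt.closed pt.smult_left pt.smult_right)
    also have "\<dots> = pure_tensor k M C m (\<Oplus>\<^bsub>C\<^esub>i\<in>I. a i d \<odot>\<^bsub>C\<^esub> c i)"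
      using aD(1) md by (intro pure_tensor_finsum_right[symmetric]) (auto simp: aD(3) cl)
    finally show "g (pure_tensor k M C m d) = id_map (tensor k M C) (pure_tensor k M C m d)"
      using md by (simp add: pt.closed aD(4))
  qed
  then show ?thesis using t by (auto simp: g_def dest: fun_cong[of _ _ t])
qed

lemma tensor_contract_eqI:
  assumes a: "dual_basis k C I a c"
    and st: "s \<in> carrier (tensor k M C)" "t \<in> carrier (tensor k M C)"
    and eq: "\<And>i. i \<in> I \<Longrightarrow> contract k M C (a i) s = contract k M C (a i) t"
  shows "s = t"
proof -
  note aD = dual_basisD[OF a]
  have "(\<Oplus>\<^bsub>tensor k M C\<^esub>i\<in>I. pure_tensor k M C (contract k M C (a i) s) (c i)) =
      (\<Oplus>\<^bsub>tensor k M C\<^esub>i\<in>I. pure_tensor k M C (contract k M C (a i) t) (c i))"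
    by (rule MC.finsum_cong')
      (auto simp: eq aD(3) intro!: pt.closed linear_maps_closed[OF contract_linear] aD(2) st)
  then show ?thesis by (simp add: tensor_expand[OF a] st)
qed

lemma dual_basis_expand_functional:
  assumes a: "dual_basis k C I a c" and f: "f \<in> carrier (dual_module k C)"
  shows "(\<Oplus>\<^bsub>dual_module k C\<^esub>i\<in>I. f (c i) \<odot>\<^bsub>dual_module k C\<^esub> a i) = f"
proof -
  interpret A: module k "dual_module k C" by (rule dual_module_module[OF C])
  interpret R: module k "ring_module k" by (rule ring_module_module[OF M.R.cring_axioms])
  note aD = dual_basisD[OF a] and fcl = dual_module_closed[OF f]
  have mem: "(\<lambda>i. f (c i) \<odot>\<^bsub>dual_module k C\<^esub> a i) \<in> I \<rightarrow> carrier (dual_module k C)"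
    by (auto simp: aD(2,3) fcl)
  show ?thesis
  proof (rule dual_module_eqI[OF A.finsum_closed[OF mem] f])
    fix y assume y: "y \<in> carrier C"
    define ev where "ev = (\<lambda>g\<in>carrier (dual_module k C). g y)"
    have ev: "ev \<in> linear_maps k (dual_module k C) (ring_module k)"
      unfolding ev_def using y
      by (intro linear_maps_restrictI A.module_axioms)
        (auto simp: dual_module_closed dual_module_apply)
    have "(\<Oplus>\<^bsub>dual_module k C\<^esub>i\<in>I. f (c i) \<odot>\<^bsub>dual_module k C\<^esub> a i) y =
        ev (\<Oplus>\<^bsub>dual_module k C\<^esub>i\<in>I. f (c i) \<odot>\<^bsub>dual_module k C\<^esub> a i)"
      unfolding ev_def using A.finsum_closed[OF mem] by simp
    also have "\<dots> = (\<Oplus>\<^bsub>ring_module k\<^esub>i\<in>I. ev (f (c i) \<odot>\<^bsub>dual_module k C\<^esub> a i))"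
      by (rule linear_maps_finsum[OF ev A.module_axioms R.module_axioms aD(1) mem])
    also have "\<dots> = (\<Oplus>\<^bsub>ring_module k\<^esub>i\<in>I. f (a i y \<odot>\<^bsub>C\<^esub> c i))"
    proof (rule R.finsum_cong'[OF refl])
      fix i assume i: "i \<in> I"
      show "ev (f (c i) \<odot>\<^bsub>dual_module k C\<^esub> a i) = f (a i y \<odot>\<^bsub>C\<^esub> c i)"
        using i y dual_module_closed[OF aD(2)[OF i] y]
        by (simp add: ev_def aD(2,3) fcl dual_module_smult[OF f] M.R.m_comm)
          (simp add: dual_module_apply M.R.m_comm aD(2,3) fcl)
    qed (use y in \<open>auto simp: aD(3) dual_module_closed[OF aD(2)] intro!: fcl\<close>)
    also have "\<dots> = f (\<Oplus>\<^bsub>C\<^esub>i\<in>I. a i y \<odot>\<^bsub>C\<^esub> c i)"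
      using f aD(1) y unfolding dual_module_simps
      by (intro linear_maps_finsum[OF _ C R.module_axioms, symmetric]) (auto simp: aD(3) dual_module_closed[OF aD(2)])
    finally show "(\<Oplus>\<^bsub>dual_module k C\<^esub>i\<in>I. f (c i) \<odot>\<^bsub>dual_module k C\<^esub> a i) y = f y"
      by (simp add: aD(4)[OF y])
  qed
qed

lemma tensor_contract_exists:
  assumes a: "dual_basis k C I a c" and h: "h \<in> linear_maps k (dual_module k C) M"
  shows "\<exists>t\<in>carrier (tensor k M C). \<forall>f\<in>carrier (dual_module k C). contract k M C f t = h f"
proof -
  interpret A: module k "dual_module k C" by (rule dual_module_module[OF C])
  note aD = dual_basisD[OF a]
  have mem: "(\<lambda>i. pure_tensor k M C (h (a i)) (c i)) \<in> I \<rightarrow> carrier (tensor k M C)"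
    by (auto intro!: pt.closed linear_maps_closed[OF h] aD(2,3))
  define t where "t = (\<Oplus>\<^bsub>tensor k M C\<^esub>i\<in>I. pure_tensor k M C (h (a i)) (c i))"
  have "contract k M C f t = h f" if f: "f \<in> carrier (dual_module k C)" for f
  proof -
    note fcl = dual_module_closed[OF f]
    have "contract k M C f t = (\<Oplus>\<^bsub>M\<^esub>i\<in>I. contract k M C f (pure_tensor k M C (h (a i)) (c i)))"
      unfolding t_def
      by (rule linear_maps_finsum[OF contract_linear[OF f] MC.module_axioms M aD(1) mem])
    also have "\<dots> = (\<Oplus>\<^bsub>M\<^esub>i\<in>I. h (f (c i) \<odot>\<^bsub>dual_module k C\<^esub> a i))"
      by (rule M.finsum_cong')
        (auto simp: contract_pure f linear_maps_closed[OF h] linear_maps_smult[OF h] aD(2,3) fcl)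
    also have "\<dots> = h (\<Oplus>\<^bsub>dual_module k C\<^esub>i\<in>I. f (c i) \<odot>\<^bsub>dual_module k C\<^esub> a i)"
      by (rule linear_maps_finsum[OF h A.module_axioms M aD(1), symmetric]) (auto simp: aD(2,3) fcl)
    also have "\<dots> = h f" by (simp add: dual_basis_expand_functional[OF a f])
    finally show ?thesis .
  qed
  moreover have "t \<in> carrier (tensor k M C)" unfolding t_def by (rule MC.finsum_closed[OF mem])
  ultimately show ?thesis by blast
qed

lemma right_unitor_contract:
  assumes e: "e \<in> carrier (dual_module k C)" and s: "s \<in> carrier (tensor k M C)"
  shows "right_unitor k M (tensor_map k M C M (ring_module k) (id_map M) e s) = contract k M C e s"
proof -
  have R: "module k (ring_module k)" by (rule ring_module_module[OF M.R.cring_axioms])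
  have bil: "bilinear_map k M (ring_module k) M (\<lambda>m r. r \<odot>\<^bsub>M\<^esub> m)"
    by unfold_locales (simp_all add: M.smult_l_distr M.smult_r_distr M.smult_assoc1[symmetric] M.R.m_comm)
  have e': "e \<in> linear_maps k C (ring_module k)" using e by (simp add: dual_module_simps)
  note tm = tensor_map_linear[OF M C M R id_map_linear[OF M] e']
    and ru = tensor_lift_linear[OF M R M bil, folded right_unitor_def]
  note lins = linear_maps_closed[OF tm] linear_maps_add[OF tm] linear_maps_zero[OF tm MC.module_axioms tensor_module[OF M R]]
    linear_maps_add[OF ru] linear_maps_zero[OF ru tensor_module[OF M R] M]
    linear_maps_add[OF contract_linear[OF e]] linear_maps_zero[OF contract_linear[OF e] MC.module_axioms M]
  show ?thesis
    using s by (induction rule: tensor_induct[OF M C, consumes 1, case_names zero add pure])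
      (simp_all add: lins tensor_map_pure[OF M C M R id_map_linear[OF M] e'] contract_pure[OF e]
        tensor_lift_pure[OF M R M bil, folded right_unitor_def] dual_module_closed[OF e])
qed

end

lemma dual_module_compose:
  assumes "module k C" "f \<in> carrier (dual_module k D)" "g \<in> linear_maps k C D"
  shows "compose (carrier C) f g \<in> carrier (dual_module k C)"
  using assms linear_maps_compose[of k C g D f "ring_module k"] by (simp add: dual_module_simps)

lemma contract_tensor_map_left:
  assumes M: "module k M" and N: "module k N" and C: "module k C"
    and f: "f \<in> linear_maps k M N" and a: "a \<in> carrier (dual_module k C)"
    and s: "s \<in> carrier (tensor k M C)"
  shows "contract k N C a (tensor_map k M C N C f (id_map C) s) = f (contract k M C a s)"
proof -
  note tm = tensor_map_linear[OF M C N C f id_map_linear[OF C]]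
    and cN = contract_linear[OF N C a] and cM = contract_linear[OF M C a]
  note lins = linear_maps_closed[OF tm] linear_maps_add[OF tm]
    linear_maps_zero[OF tm tensor_module[OF M C] tensor_module[OF N C]]
    linear_maps_add[OF cN] linear_maps_zero[OF cN tensor_module[OF N C] N]
    linear_maps_closed[OF cM] linear_maps_add[OF cM] linear_maps_zero[OF cM tensor_module[OF M C] M]
    linear_maps_closed[OF f] linear_maps_add[OF f] linear_maps_zero[OF f M N] linear_maps_smult[OF f]
  show ?thesis
    using s by (induction rule: tensor_induct[OF M C, consumes 1, case_names zero add pure])
      (simp_all add: lins tensor_map_pure[OF M C N C f id_map_linear[OF C]] contract_pure[OF M C a]
        contract_pure[OF N C a] dual_module_closed[OF a])
qed

lemma contract_tensor_map_right:
  assumes M: "module k M" and C: "module k C" and D: "module k D"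
    and g: "g \<in> linear_maps k C D" and f: "f \<in> carrier (dual_module k D)"
    and s: "s \<in> carrier (tensor k M C)"
  shows "contract k M D f (tensor_map k M C M D (id_map M) g s) =
    contract k M C (compose (carrier C) f g) s"
proof -
  note fg = dual_module_compose[OF C f g]
  note tm = tensor_map_linear[OF M C M D id_map_linear[OF M] g]
    and cD = contract_linear[OF M D f] and cC = contract_linear[OF M C fg]
  note lins = linear_maps_closed[OF tm] linear_maps_add[OF tm]
    linear_maps_zero[OF tm tensor_module[OF M C] tensor_module[OF M D]]
    linear_maps_add[OF cD] linear_maps_zero[OF cD tensor_module[OF M D] M]
    linear_maps_add[OF cC] linear_maps_zero[OF cC tensor_module[OF M C] M]
  show ?thesis
    using s by (induction rule: tensor_induct[OF M C, consumes 1, case_names zero add pure])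
      (simp_all add: lins tensor_map_pure[OF M C M D id_map_linear[OF M] g] contract_pure[OF M D f]
        contract_pure[OF M C fg] linear_maps_closed[OF g] compose_eq)
qed

lemma contract_tensor_assoc:
  assumes M: "module k M" and C: "module k C" and D: "module k D"
    and b: "b \<in> carrier (dual_module k C)" and a: "a \<in> carrier (dual_module k D)"
    and s: "s \<in> carrier (tensor k (tensor k M C) D)"
  shows "contract k M (tensor k C D) (tensor_functional k C D b a) (tensor_assoc k M C D s) =
    contract k M C b (contract k (tensor k M C) D a s)"
proof -
  interpret M: module k M by fact
  note MC = tensor_module[OF M C] and CD = tensor_module[OF C D]
  note tf = tensor_functional_closed[OF C D b a]
  note as = tensor_assoc_linear[OF M C D] and cM = contract_linear[OF M CD tf]
    and cb = contract_linear[OF M C b] and ca = contract_linear[OF MC D a]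
  note lins = linear_maps_closed[OF as] linear_maps_add[OF as]
    linear_maps_zero[OF as tensor_module[OF MC D] tensor_module[OF M CD]]
    linear_maps_closed[OF cM] linear_maps_add[OF cM] linear_maps_zero[OF cM tensor_module[OF M CD] M]
    linear_maps_closed[OF cb] linear_maps_add[OF cb] linear_maps_zero[OF cb MC M] linear_maps_smult[OF cb]
    linear_maps_closed[OF ca] linear_maps_add[OF ca] linear_maps_zero[OF ca tensor_module[OF MC D] MC]
  have pure: "contract k M (tensor k C D) (tensor_functional k C D b a)
      (tensor_assoc k M C D (pure_tensor k (tensor k M C) D t d)) = a d \<odot>\<^bsub>M\<^esub> contract k M C b t"
    if "t \<in> carrier (tensor k M C)" and d: "d \<in> carrier D" for t d
  proof -
    interpret MCD: bilinear_map k "tensor k M C" D "tensor k (tensor k M C) D" "pure_tensor k (tensor k M C) D"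
      by (rule bilinear_map_pure_tensor[OF MC D])
    interpret CD: bilinear_map k C D "tensor k C D" "pure_tensor k C D"
      by (rule bilinear_map_pure_tensor[OF C D])
    show ?thesis
      using that(1)
    proof (induction rule: tensor_induct[OF M C, consumes 1, case_names zero add pure])
      case zero
      show ?case
        using linear_maps_zero[OF pure_tensor_linear_left[OF MC D d] MC tensor_module[OF MC D]]
          d dual_module_closed[OF a d] module.axioms(2)[OF MC]
        by (simp add: lins abelian_group_def abelian_monoid.zero_closed)
    next
      case (add s t)
      then show ?case
        using d dual_module_closed[OF a d]
        by (simp add: MCD.add_left MCD.closed lins M.smult_r_distr)
    next
      case (pure m c)
      then show ?case
        using d dual_module_closed[OF a d] dual_module_closed[OF b]
        by (simp add: tensor_assoc_pure[OF M C D] contract_pure[OF M CD tf] CD.closed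
            tensor_functional_pure[OF C D b a] contract_pure[OF M C b] M.smult_assoc1)
    qed
  qed
  show ?thesis
    using s by (induction rule: tensor_induct[OF MC D, consumes 1, case_names zero add pure])
      (simp_all add: lins pure contract_pure[OF MC D a] dual_module_closed[OF a])
qed


section \<open>Coactions and actions\<close>

definition to_action :: "'k ring \<Rightarrow> ('k, 'm) module \<Rightarrow> ('k, 'n) module \<Rightarrow> ('k, 'c) module \<Rightarrow>
    ('m \<Rightarrow> ('n \<times> 'c \<Rightarrow> 'k) set) \<Rightarrow> ('m \<times> ('c \<Rightarrow> 'k) \<Rightarrow> 'k) set \<Rightarrow> 'n" where
  "to_action k M N C \<rho> = tensor_lift k M (dual_module k C) N (\<lambda>m a. contract k N C a (\<rho> m))"

text \<open>The described element is unique as soon as \<open>C\<close> has a dual basis.\<close>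

definition to_coaction :: "'k ring \<Rightarrow> ('k, 'm) module \<Rightarrow> ('k, 'n) module \<Rightarrow> ('k, 'c) module \<Rightarrow>
    (('m \<times> ('c \<Rightarrow> 'k) \<Rightarrow> 'k) set \<Rightarrow> 'n) \<Rightarrow> 'm \<Rightarrow> ('n \<times> 'c \<Rightarrow> 'k) set" where
  "to_coaction k M N C \<mu> = (\<lambda>m\<in>carrier M. THE t. t \<in> carrier (tensor k N C) \<and>
     (\<forall>a\<in>carrier (dual_module k C). contract k N C a t = \<mu> (pure_tensor k M (dual_module k C) m a)))"

lemma contract_eqI:
  assumes "module k M" "module k C" and basis: "dual_basis k C I d c"
    and "s \<in> carrier (tensor k M C)" "t \<in> carrier (tensor k M C)"
    and "\<And>a. a \<in> carrier (dual_module k C) \<Longrightarrow> contract k M C a s = contract k M C a t"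
  shows "s = t"
  using assms dual_basisD(2)[OF basis] by (intro tensor_contract_eqI[OF _ _ basis]) auto

context
  fixes k :: "'k ring" and M :: "('k, 'm) module" and N :: "('k, 'n) module" and C :: "('k, 'c) module"
  assumes M: "module k M" and N: "module k N" and C: "module k C"
begin

private lemmas A = dual_module_module[OF C]

lemma to_action_bilinear:
  assumes \<rho>: "\<rho> \<in> linear_maps k M (tensor k N C)"
  shows "bilinear_map k M (dual_module k C) N (\<lambda>m a. contract k N C a (\<rho> m))"
proof -
  note c = contract_linear[OF N C]
  show ?thesis
    by unfold_locales
      (simp_all add: linear_maps_closed[OF c] linear_maps_add[OF c] linear_maps_smult[OF c]
        linear_maps_closed[OF \<rho>] linear_maps_add[OF \<rho>] linear_maps_smult[OF \<rho>]
        contract_addf[OF N C] contract_smultf[OF N C])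
qed

lemma to_action_linear:
  "\<rho> \<in> linear_maps k M (tensor k N C) \<Longrightarrow>
    to_action k M N C \<rho> \<in> linear_maps k (tensor k M (dual_module k C)) N"
  unfolding to_action_def by (rule tensor_lift_linear[OF M A N to_action_bilinear])

lemma to_action_pure:
  "\<lbrakk>\<rho> \<in> linear_maps k M (tensor k N C); m \<in> carrier M; a \<in> carrier (dual_module k C)\<rbrakk> \<Longrightarrow>
    to_action k M N C \<rho> (pure_tensor k M (dual_module k C) m a) = contract k N C a (\<rho> m)"
  unfolding to_action_def by (rule tensor_lift_pure[OF M A N to_action_bilinear])

context
  fixes I :: "'i set" and d c
  assumes basis: "dual_basis k C I d c"
begin

lemma to_coaction_eqI:
  assumes "m \<in> carrier M" "t \<in> carrier (tensor k N C)"
    and "\<And>a. a \<in> carrier (dual_module k C) \<Longrightarrow>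
      contract k N C a t = \<mu> (pure_tensor k M (dual_module k C) m a)"
  shows "to_coaction k M N C \<mu> m = t"
  unfolding to_coaction_def restrict_apply'[OF assms(1)]
proof (rule the_equality)
  fix s assume s: "s \<in> carrier (tensor k N C) \<and> (\<forall>a\<in>carrier (dual_module k C).
    contract k N C a s = \<mu> (pure_tensor k M (dual_module k C) m a))"
  show "s = t" by (rule contract_eqI[OF N C basis]) (use s assms in auto)
qed (use assms in auto)

lemma to_coaction_contract:
  assumes \<mu>: "\<mu> \<in> linear_maps k (tensor k M (dual_module k C)) N" and m: "m \<in> carrier M"
  shows "to_coaction k M N C \<mu> m \<in> carrier (tensor k N C)"
    and "a \<in> carrier (dual_module k C) \<Longrightarrow>
      contract k N C a (to_coaction k M N C \<mu> m) = \<mu> (pure_tensor k M (dual_module k C) m a)"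
proof -
  interpret pt: bilinear_map k M "dual_module k C" "tensor k M (dual_module k C)"
      "pure_tensor k M (dual_module k C)"
    by (rule bilinear_map_pure_tensor[OF M A])
  have h: "(\<lambda>a\<in>carrier (dual_module k C). \<mu> (pure_tensor k M (dual_module k C) m a))
      \<in> linear_maps k (dual_module k C) N"
    using m by (intro linear_maps_restrictI[OF A])
      (auto simp: pt.closed pt.add_right pt.smult_right linear_maps_closed[OF \<mu>]
        linear_maps_add[OF \<mu>] linear_maps_smult[OF \<mu>])
  obtain t where t: "t \<in> carrier (tensor k N C)"
    "\<And>a. a \<in> carrier (dual_module k C) \<Longrightarrow>
      contract k N C a t = \<mu> (pure_tensor k M (dual_module k C) m a)"
    using tensor_contract_exists[OF N C basis h] by auto
  have eq: "to_coaction k M N C \<mu> m = t" by (rule to_coaction_eqI[OF m t])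
  show "to_coaction k M N C \<mu> m \<in> carrier (tensor k N C)" using t eq by simp
  show "contract k N C a (to_coaction k M N C \<mu> m) = \<mu> (pure_tensor k M (dual_module k C) m a)"
    if "a \<in> carrier (dual_module k C)" using t(2)[OF that] eq by simp
qed

lemma to_coaction_linear:
  assumes \<mu>: "\<mu> \<in> linear_maps k (tensor k M (dual_module k C)) N"
  shows "to_coaction k M N C \<mu> \<in> linear_maps k M (tensor k N C)"
proof -
  interpret pt: bilinear_map k M "dual_module k C" "tensor k M (dual_module k C)"
      "pure_tensor k M (dual_module k C)"
    by (rule bilinear_map_pure_tensor[OF M A])
  interpret M: module k M by (rule M)
  interpret NC: module k "tensor k N C" by (rule tensor_module[OF N C])
  note spec = to_coaction_contract[OF \<mu>] and cl = linear_maps_add[OF contract_linear[OF N C]]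
    linear_maps_smult[OF contract_linear[OF N C]]
  show ?thesis
  proof (rule linear_mapsI)
    fix m m' assume "m \<in> carrier M" "m' \<in> carrier M"
    then show "to_coaction k M N C \<mu> (m \<oplus>\<^bsub>M\<^esub> m') =
        to_coaction k M N C \<mu> m \<oplus>\<^bsub>tensor k N C\<^esub> to_coaction k M N C \<mu> m'"
      by (intro to_coaction_eqI) (auto simp: spec cl pt.add_left linear_maps_add[OF \<mu>] pt.closed)
  next
    fix r m assume "r \<in> carrier k" "m \<in> carrier M"
    then show "to_coaction k M N C \<mu> (r \<odot>\<^bsub>M\<^esub> m) = r \<odot>\<^bsub>tensor k N C\<^esub> to_coaction k M N C \<mu> m"
      by (intro to_coaction_eqI) (auto simp: spec cl pt.smult_left linear_maps_smult[OF \<mu>] pt.closed)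
  qed (simp_all add: spec, simp add: to_coaction_def)
qed

lemma to_coaction_to_action:
  assumes \<rho>: "\<rho> \<in> linear_maps k M (tensor k N C)"
  shows "to_coaction k M N C (to_action k M N C \<rho>) = \<rho>"
  by (rule linear_maps_eqI[OF to_coaction_linear[OF to_action_linear[OF \<rho>]] \<rho>])
    (rule to_coaction_eqI, simp_all add: to_action_pure[OF \<rho>] linear_maps_closed[OF \<rho>])

lemma to_action_to_coaction:
  assumes \<mu>: "\<mu> \<in> linear_maps k (tensor k M (dual_module k C)) N"
  shows "to_action k M N C (to_coaction k M N C \<mu>) = \<mu>"
  unfolding to_action_def
  by (rule tensor_lift_unique[OF M A N \<mu>]) (simp add: to_coaction_contract[OF \<mu>])

end

end


section \<open>Categories\<close>

lemma isomorphic_categoriesI: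
  assumes "category \<D>"
    and Fo: "\<And>P. P \<in> Obj \<C> \<Longrightarrow> Fo P \<in> Obj \<D>" and Go: "\<And>P. P \<in> Obj \<D> \<Longrightarrow> Go P \<in> Obj \<C>"
    and GF: "\<And>P. P \<in> Obj \<C> \<Longrightarrow> Go (Fo P) = P" and FG: "\<And>P. P \<in> Obj \<D> \<Longrightarrow> Fo (Go P) = P"
    and Arr: "\<And>P Q. \<lbrakk>P \<in> Obj \<C>; Q \<in> Obj \<C>\<rbrakk> \<Longrightarrow> Arr \<C> P Q = Arr \<D> (Fo P) (Fo Q)"
    and Ident: "\<And>P. P \<in> Obj \<C> \<Longrightarrow> Ident \<C> P = Ident \<D> (Fo P)"
    and Compose: "\<And>P Q R. \<lbrakk>P \<in> Obj \<C>; Q \<in> Obj \<C>; R \<in> Obj \<C>\<rbrakk> \<Longrightarrow>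
      Compose \<C> P Q R = Compose \<D> (Fo P) (Fo Q) (Fo R)"
  shows "isomorphic_categories \<C> \<D>"
proof -
  interpret D: category \<D> by fact
  interpret C: category \<C>
    by standard (simp_all add: Arr Ident Compose Fo D.Ident_in D.Compose_in D.Ident_left D.Ident_right,
        rule D.Compose_assoc, simp_all add: Fo)
  have "cat_functor \<C> \<D> Fo (\<lambda>P Q f. f)"
    by standard (simp_all add: Fo Arr Ident Compose)
  moreover have "cat_functor \<D> \<C> Go (\<lambda>P Q f. f)"
    by standard (simp_all add: Go FG Arr Ident Compose)
  ultimately show ?thesis
    unfolding isomorphic_categories_def using GF FG by blast
qed

lemma fgp_families_module:
  "\<lbrakk>M \<in> fgp_families k X; x \<in> X; y \<in> X\<rbrakk> \<Longrightarrow> module k (M x y)"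
  by (auto simp: fgp_families_def fgp_modules_def PiE_iff)

lemma family_maps_linear:
  "\<lbrakk>f \<in> family_maps k X M N; x \<in> X; y \<in> X\<rbrakk> \<Longrightarrow> f x y \<in> linear_maps k (M x y) (N x y)"
  by (auto simp: family_maps_def PiE_iff)

lemma family_maps_eqI:
  assumes "f \<in> family_maps k X M N" "g \<in> family_maps k X M N"
    and "\<And>x y m. \<lbrakk>x \<in> X; y \<in> X; m \<in> carrier (M x y)\<rbrakk> \<Longrightarrow> f x y m = g x y m"
  shows "f = g"
proof (rule PiE_ext[OF assms(1)[unfolded family_maps_def] assms(2)[unfolded family_maps_def]])
  fix x assume x: "x \<in> X"
  show "f x = g x"
  proof (rule PiE_ext)
    show "f x \<in> (\<Pi>\<^sub>E y\<in>X. linear_maps k (M x y) (N x y))"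
      "g x \<in> (\<Pi>\<^sub>E y\<in>X. linear_maps k (M x y) (N x y))"
      using assms(1,2) x by (auto simp: family_maps_def PiE_iff)
    fix y assume y: "y \<in> X"
    show "f x y = g x y"
      using assms x y by (intro linear_maps_eqI[OF family_maps_linear family_maps_linear])
  qed
qed

lemma family_id_maps:
  assumes "M \<in> fgp_families k X"
  shows "family_id X M \<in> family_maps k X M M"
  by (auto simp: family_id_def family_maps_def intro!: id_map_linear fgp_families_module[OF assms])

lemma family_comp_maps:
  assumes "M \<in> fgp_families k X" "f \<in> family_maps k X M N" "g \<in> family_maps k X N P"
  shows "family_comp X M g f \<in> family_maps k X M P"
proof -
  have "compose (carrier (M x y)) (g x y) (f x y) \<in> linear_maps k (M x y) (P x y)"
    if "x \<in> X" "y \<in> X" for x y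
    by (rule linear_maps_compose[OF fgp_families_module[OF assms(1) that]
          family_maps_linear[OF assms(2) that] family_maps_linear[OF assms(3) that]])
  then show ?thesis by (auto simp: family_comp_def family_maps_def)
qed

lemma act_closed:
  assumes "(M, \<mu>) \<in> right_modules k X A" "module k (mod_hom A y z)"
    and "x \<in> X" "y \<in> X" "z \<in> X" "m \<in> carrier (M x y)" "a \<in> carrier (mod_hom A y z)"
  shows "act k A M \<mu> x y z m a \<in> carrier (M x z)"
proof -
  have M: "M \<in> fgp_families k X"
    and \<mu>: "\<mu> x y z \<in> linear_maps k (tensor k (M x y) (mod_hom A y z)) (M x z)"
    using assms by (auto simp: right_modules_def PiE_iff)
  have "module k (M x y)" using M assms by (intro fgp_families_module)
  then show ?thesis
    unfolding act_def using assms
    by (intro linear_maps_closed[OF \<mu>] bilinear_map.closed[OF bilinear_map_pure_tensor])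
qed

lemma module_category_category:
  fixes A :: "('x, 'k, 'a) linear_cat"
  assumes A: "\<And>y z. \<lbrakk>y \<in> X; z \<in> X\<rbrakk> \<Longrightarrow> module k (mod_hom A y z)"
  shows "category (module_category k X A :: ('x, 'k, 'm, 'a) module_cat)"
proof -
  have fam: "fst P \<in> fgp_families k X" if "P \<in> right_modules k X A" for P :: "('x, 'k, 'm) family \<times> _"
    using that by (auto simp: right_modules_def)
  have maps: "f \<in> family_maps k X (fst P) (fst Q)" if "f \<in> module_maps k X A P Q"
    for f and P Q :: "('x, 'k, 'm) family \<times> _"
    using that by (cases P; cases Q) (simp add: module_maps_def)
  note maps_closed = maps[THEN family_maps_linear, THEN linear_maps_closed]
  have eq: "f = g" if "f \<in> module_maps k X A P Q" "g \<in> module_maps k X A P Q"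
    "\<And>x y m. \<lbrakk>x \<in> X; y \<in> X; m \<in> carrier (fst P x y)\<rbrakk> \<Longrightarrow> f x y m = g x y m"
    for f g and P Q :: "('x, 'k, 'm) family \<times> _"
    using family_maps_eqI[OF maps[OF that(1)] maps[OF that(2)] that(3)] .
  have id: "family_id X (fst P) \<in> module_maps k X A P P" if "P \<in> right_modules k X A"
    for P :: "('x, 'k, 'm) family \<times> _"
    using that family_id_maps[OF fam[OF that]]
    by (cases P) (auto simp: module_maps_def family_id_def act_closed[where X = X, OF _ A])
  have comp: "family_comp X (fst P) g f \<in> module_maps k X A P R"
    if "P \<in> right_modules k X A" "f \<in> module_maps k X A P Q" "g \<in> module_maps k X A Q R"
    for f g and P Q R :: "('x, 'k, 'm) family \<times> _"
  proof -
    obtain M \<mu> N \<nu> L \<kappa> where PQR: "P = (M, \<mu>)" "Q = (N, \<nu>)" "R = (L, \<kappa>)"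
      by (cases P; cases Q; cases R)
    have fcl: "f x y m \<in> carrier (N x y)" if "x \<in> X" "y \<in> X" "m \<in> carrier (M x y)" for x y m
      using maps_closed[OF \<open>f \<in> _\<close>] that PQR by simp
    note act_closed = act_closed[OF that(1)[unfolded PQR] A]
    show ?thesis
      using that family_comp_maps[OF fam[OF that(1)] maps[OF that(2)] maps[OF that(3)]]
      unfolding PQR by (simp add: module_maps_def family_comp_def compose_eq act_closed fcl)
  qed
  have comp_apply: "family_comp X M g f x y m = g x y (f x y m)"
    if "x \<in> X" "y \<in> X" "m \<in> carrier (M x y)"
    for f g :: "'x \<Rightarrow> 'x \<Rightarrow> 'm \<Rightarrow> 'm" and M :: "('x, 'k, 'm) family" and x y m
    using that by (simp add: family_comp_def compose_eq)
  have id_apply: "family_id X M x y m = m" if "x \<in> X" "y \<in> X" "m \<in> carrier (M x y)"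
    for M :: "('x, 'k, 'm) family" and x y m
    using that by (simp add: family_id_def)
  show ?thesis
  proof (unfold_locales, simp_all add: module_category_def)
    fix P Q :: "('x, 'k, 'm) family \<times> _" and f
    assume P: "P \<in> right_modules k X A" and Q: "Q \<in> right_modules k X A"
      and f: "f \<in> module_maps k X A P Q"
    show "family_comp X (fst P) (family_id X (fst Q)) f = f"
      by (rule eq[OF comp[OF P f id[OF Q]] f]) (simp add: comp_apply id_apply maps_closed[OF f])
    show "family_comp X (fst P) f (family_id X (fst P)) = f"
      by (rule eq[OF comp[OF P id[OF P] f] f]) (simp add: comp_apply id_apply)
  next
    fix P Q R S :: "('x, 'k, 'm) family \<times> _" and f g h
    assume P: "P \<in> right_modules k X A" and Q: "Q \<in> right_modules k X A"
      and R: "R \<in> right_modules k X A"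
      and f: "f \<in> module_maps k X A P Q" and g: "g \<in> module_maps k X A Q R"
      and h: "h \<in> module_maps k X A R S"
    show "family_comp X (fst P) h (family_comp X (fst P) g f) =
        family_comp X (fst P) (family_comp X (fst Q) h g) f"
      by (rule eq[OF comp[OF P comp[OF P f g] h] comp[OF P f comp[OF Q g h]]])
        (simp add: comp_apply maps_closed[OF f])
  qed (simp_all add: id comp)
qed


section \<open>The isomorphism\<close>

locale fgp_dual_linear_category = dual_linear_category k X C
  for k :: "'k ring" and X :: "'x set" and C :: "('x, 'k, 'c) dual_linear_cat" +
  assumes hom_finitely_generated: "\<lbrakk>x \<in> X; y \<in> X\<rbrakk> \<Longrightarrow> finitely_generated k (comod_hom C x y)"
    and hom_projective: "\<lbrakk>x \<in> X; y \<in> X\<rbrakk> \<Longrightarrow> projective k (comod_hom C x y)"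
begin

abbreviation "H \<equiv> comod_hom C"

abbreviation "A \<equiv> dual_to_linear_cat k C"

lemma mod_hom_A [simp]: "mod_hom A x y = dual_module k (H y x)"
  and unit_elem_A [simp]: "unit_elem A = counit C"
  by (simp_all add: dual_to_linear_cat_def Let_def)

lemma hom_dual_basis:
  assumes "x \<in> X" "y \<in> X"
  obtains I d c where "dual_basis k (H x y) (I :: 'c set) d c"
  using finitely_generated_projective_dual_basis[OF comod_hom_module[OF assms]
      hom_finitely_generated[OF assms] hom_projective[OF assms]] by blast

lemma counit_dual: "x \<in> X \<Longrightarrow> counit C x \<in> carrier (dual_module k (H x x))"
  using counit_linear by (simp add: dual_module_simps)

lemma comp_map_A_pure:
  assumes xyz: "x \<in> X" "y \<in> X" "z \<in> X"
    and a: "a \<in> carrier (dual_module k (H y x))" and b: "b \<in> carrier (dual_module k (H z y))"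
  shows "comp_map A x y z (pure_tensor k (dual_module k (H y x)) (dual_module k (H z y)) a b) =
    compose (carrier (H z x)) (tensor_functional k (H z y) (H y x) b a) (coprod C z y x)"
proof -
  note mods = comod_hom_module[OF xyz(3,2)] comod_hom_module[OF xyz(2,1)]
  note zx = comod_hom_module[OF xyz(3,1)]
  note R = ring_module_module[OF cring_axioms]
  note cop = linear_maps_closed[OF coprod_linear[OF xyz(3,2,1)]]
  let ?b = "\<lambda>a b. compose (carrier (H z x)) (tensor_functional k (H z y) (H y x) b a) (coprod C z y x)"
  interpret A1: module k "dual_module k (H y x)" by (rule dual_module_module[OF mods(2)])
  interpret A2: module k "dual_module k (H z y)" by (rule dual_module_module[OF mods(1)])
  interpret A3: module k "dual_module k (H z x)" by (rule dual_module_module[OF zx])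
  note tf_bil = tensor_functional_bilinear[OF mods]
  have closed: "?b a b \<in> carrier (dual_module k (H z x))"
    if "a \<in> carrier (dual_module k (H y x))" "b \<in> carrier (dual_module k (H z y))" for a b
    using that by (intro dual_module_compose[OF zx _ coprod_linear[OF xyz(3,2,1)]] tensor_functional_closed mods)
  have bil: "bilinear_map k (dual_module k (H y x)) (dual_module k (H z y)) (dual_module k (H z x)) ?b"
  proof (unfold_locales, goal_cases)
    case (1 a b)
    then show ?case by (rule closed)
  next
    case (2 a a' b)
    then show ?case
      by (intro dual_module_eqI[of _ k "H z x"] closed A3.a_closed A1.a_closed)
        (auto simp: compose_eq dual_module_apply tensor_functional_def dual_module_closed l_distr
          intro!: tensor_lift_addf[OF mods R tf_bil tf_bil tf_bil, simplified] cop)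
  next
    case (3 a b b')
    then show ?case
      by (intro dual_module_eqI[of _ k "H z x"] closed A3.a_closed A2.a_closed)
        (auto simp: compose_eq dual_module_apply tensor_functional_def dual_module_closed r_distr
          intro!: tensor_lift_addf[OF mods R tf_bil tf_bil tf_bil, simplified] cop)
  next
    case (4 r a b)
    then show ?case
      by (intro dual_module_eqI[of _ k "H z x"] closed A3.smult_closed A1.smult_closed)
        (auto simp: compose_eq dual_module_apply tensor_functional_def dual_module_closed m_assoc
          intro!: tensor_lift_smultf[OF mods R tf_bil tf_bil, simplified] cop)
  next
    case (5 r a b)
    then show ?case
      by (intro dual_module_eqI[of _ k "H z x"] closed A3.smult_closed A2.smult_closed)
        (auto simp: compose_eq dual_module_apply tensor_functional_def dual_module_closed m_lcomm
          intro!: tensor_lift_smultf[OF mods R tf_bil tf_bil, simplified] cop)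
  qed
  have "comp_map A x y z = tensor_lift k (dual_module k (H y x)) (dual_module k (H z y)) (dual_module k (H z x)) ?b"
    by (simp add: dual_to_linear_cat_def Let_def tensor_functional_def compose_def)
  then show ?thesis
    using tensor_lift_pure[OF A1.module_axioms A2.module_axioms A3.module_axioms bil a b] by simp
qed

definition action :: "('x, 'k, 'm) family \<Rightarrow> ('x, 'k, 'm, 'c) coaction \<Rightarrow> ('x, 'k, 'm, 'c \<Rightarrow> 'k) action" where
  "action M \<rho> = (\<lambda>x\<in>X. \<lambda>y\<in>X. \<lambda>z\<in>X. to_action k (M x y) (M x z) (H z y) (\<rho> x z y))"

definition coaction :: "('x, 'k, 'm) family \<Rightarrow> ('x, 'k, 'm, 'c \<Rightarrow> 'k) action \<Rightarrow> ('x, 'k, 'm, 'c) coaction" where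
  "coaction M \<mu> = (\<lambda>x\<in>X. \<lambda>y\<in>X. \<lambda>z\<in>X. to_coaction k (M x z) (M x y) (H y z) (\<mu> x z y))"

definition coactions :: "('x, 'k, 'm) family \<Rightarrow> ('x, 'k, 'm, 'c) coaction set" where
  "coactions M = (\<Pi>\<^sub>E x\<in>X. \<Pi>\<^sub>E y\<in>X. \<Pi>\<^sub>E z\<in>X. linear_maps k (M x z) (tensor k (M x y) (H y z)))"

definition actions :: "('x, 'k, 'm) family \<Rightarrow> ('x, 'k, 'm, 'c \<Rightarrow> 'k) action set" where
  "actions M = (\<Pi>\<^sub>E x\<in>X. \<Pi>\<^sub>E y\<in>X. \<Pi>\<^sub>E z\<in>X. linear_maps k (tensor k (M x y) (mod_hom A y z)) (M x z))"

lemma coactions_linear: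
  "\<lbrakk>\<rho> \<in> coactions M; x \<in> X; y \<in> X; z \<in> X\<rbrakk> \<Longrightarrow> \<rho> x y z \<in> linear_maps k (M x z) (tensor k (M x y) (H y z))"
  by (auto simp: coactions_def PiE_iff)

lemma actions_linear:
  "\<lbrakk>\<mu> \<in> actions M; x \<in> X; y \<in> X; z \<in> X\<rbrakk> \<Longrightarrow>
    \<mu> x y z \<in> linear_maps k (tensor k (M x y) (dual_module k (H z y))) (M x z)"
  by (auto simp: actions_def PiE_iff)

lemma triple_family_eqI:
  assumes "f \<in> (\<Pi>\<^sub>E x\<in>X. \<Pi>\<^sub>E y\<in>X. \<Pi>\<^sub>E z\<in>X. S x y z)"
    and "\<And>x y z. \<lbrakk>x \<in> X; y \<in> X; z \<in> X\<rbrakk> \<Longrightarrow> g x y z = f x y z"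
  shows "(\<lambda>x\<in>X. \<lambda>y\<in>X. \<lambda>z\<in>X. g x y z) = f"
proof (intro ext)
  fix x y z
  show "(\<lambda>x\<in>X. \<lambda>y\<in>X. \<lambda>z\<in>X. g x y z) x y z = f x y z"
    using assms by (cases "x \<in> X"; cases "y \<in> X"; cases "z \<in> X") (auto simp: PiE_iff extensional_def)
qed

lemma action_in:
  assumes "M \<in> fgp_families k X" "\<rho> \<in> coactions M"
  shows "action M \<rho> \<in> actions M"
  unfolding action_def actions_def
  by (auto intro!: to_action_linear fgp_families_module[OF assms(1)] comod_hom_module
      coactions_linear[OF assms(2)])

lemma coaction_in:
  assumes "M \<in> fgp_families k X" "\<mu> \<in> actions M"
  shows "coaction M \<mu> \<in> coactions M"
proof -
  have "to_coaction k (M x z) (M x y) (H y z) (\<mu> x z y) \<in> linear_maps k (M x z) (tensor k (M x y) (H y z))"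
    if xyz: "x \<in> X" "y \<in> X" "z \<in> X" for x y z
  proof -
    obtain I d c where "dual_basis k (H y z) (I :: 'c set) d c"
      by (rule hom_dual_basis[OF xyz(2,3)])
    then show ?thesis
      using assms xyz by (intro to_coaction_linear fgp_families_module comod_hom_module actions_linear)
  qed
  then show ?thesis by (auto simp: coaction_def coactions_def)
qed

lemma coaction_action:
  assumes "M \<in> fgp_families k X" "\<rho> \<in> coactions M"
  shows "coaction M (action M \<rho>) = \<rho>"
  unfolding coaction_def
proof (rule triple_family_eqI[OF assms(2)[unfolded coactions_def]])
  fix x y z assume xyz: "x \<in> X" "y \<in> X" "z \<in> X"
  obtain I d c where "dual_basis k (H y z) (I :: 'c set) d c"
    by (rule hom_dual_basis[OF xyz(2,3)])
  then have "to_coaction k (M x z) (M x y) (H y z) (to_action k (M x z) (M x y) (H y z) (\<rho> x y z)) = \<rho> x y z"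
    using assms xyz by (intro to_coaction_to_action fgp_families_module comod_hom_module coactions_linear)
  then show "to_coaction k (M x z) (M x y) (H y z) (action M \<rho> x z y) = \<rho> x y z"
    using xyz by (simp add: action_def)
qed

lemma action_coaction:
  assumes "M \<in> fgp_families k X" "\<mu> \<in> actions M"
  shows "action M (coaction M \<mu>) = \<mu>"
  unfolding action_def
proof (rule triple_family_eqI[OF assms(2)[unfolded actions_def]])
  fix x y z assume xyz: "x \<in> X" "y \<in> X" "z \<in> X"
  obtain I d c where "dual_basis k (H z y) (I :: 'c set) d c"
    by (rule hom_dual_basis[OF xyz(3,2)])
  then have "to_action k (M x y) (M x z) (H z y) (to_coaction k (M x y) (M x z) (H z y) (\<mu> x y z)) = \<mu> x y z"
    using assms xyz by (intro to_action_to_coaction fgp_families_module comod_hom_module actions_linear)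
  then show "to_action k (M x y) (M x z) (H z y) (coaction M \<mu> x z y) = \<mu> x y z"
    using xyz by (simp add: coaction_def)
qed

context
  fixes M :: "('x, 'k, 'm) family" and \<rho> :: "('x, 'k, 'm, 'c) coaction"
  assumes M: "M \<in> fgp_families k X" and \<rho>: "\<rho> \<in> coactions M"
begin

lemma act_action:
  assumes "x \<in> X" "y \<in> X" "z \<in> X" "m \<in> carrier (M x y)" "a \<in> carrier (dual_module k (H z y))"
  shows "act k A M (action M \<rho>) x y z m a = contract k (M x z) (H z y) a (\<rho> x z y m)"
proof -
  have "act k A M (action M \<rho>) x y z m a =
      to_action k (M x y) (M x z) (H z y) (\<rho> x z y) (pure_tensor k (M x y) (dual_module k (H z y)) m a)"
    using assms by (simp add: act_def action_def)
  also have "\<dots> = contract k (M x z) (H z y) a (\<rho> x z y m)"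
    using assms by (intro to_action_pure fgp_families_module[OF M] comod_hom_module coactions_linear[OF \<rho>])
  finally show ?thesis .
qed

lemma coassociative_iff_associative:
  assumes X: "x \<in> X" "u \<in> X" "y \<in> X" "z \<in> X" and m: "m \<in> carrier (M x z)"
  shows "tensor_assoc k (M x u) (H u y) (H y z)
      (tensor_map k (M x y) (H y z) (tensor k (M x u) (H u y)) (H y z) (\<rho> x u y) (id_map (H y z)) (\<rho> x y z m))
    = tensor_map k (M x u) (H u z) (M x u) (tensor k (H u y) (H y z)) (id_map (M x u)) (coprod C u y z) (\<rho> x u z m)
    \<longleftrightarrow> (\<forall>a\<in>carrier (mod_hom A z y). \<forall>b\<in>carrier (mod_hom A y u).
      act k A M (action M \<rho>) x y u (act k A M (action M \<rho>) x z y m a) b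
      = act k A M (action M \<rho>) x z u m (comp_map A z y u (pure_tensor k (mod_hom A z y) (mod_hom A y u) a b)))"
    (is "?L = ?R \<longleftrightarrow> _")
proof -
  note Mm = fgp_families_module[OF M] and Hm = comod_hom_module
  have mods: "module k (M x u)" "module k (M x y)" "module k (H u y)" "module k (H y z)" "module k (H u z)"
    using X by (auto intro: Mm Hm)
  note \<rho>xuy = coactions_linear[OF \<rho> X(1,2,3)] and \<rho>xyz = coactions_linear[OF \<rho> X(1,3,4)]
    and \<rho>xuz = coactions_linear[OF \<rho> X(1,2,4)] and cop = coprod_linear[OF X(2,3,4)]
  note tens = tensor_module[OF mods(1,3)] tensor_module[OF mods(3,4)]
  have tm: "tensor_map k (M x y) (H y z) (tensor k (M x u) (H u y)) (H y z) (\<rho> x u y) (id_map (H y z)) (\<rho> x y z m)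
      \<in> carrier (tensor k (tensor k (M x u) (H u y)) (H y z))"
    using linear_maps_closed[OF tensor_map_linear[OF mods(2,4) tens(1) mods(4) \<rho>xuy id_map_linear[OF mods(4)]]
        linear_maps_closed[OF \<rho>xyz m]] .
  have L: "?L \<in> carrier (tensor k (M x u) (tensor k (H u y) (H y z)))"
    by (rule linear_maps_closed[OF tensor_assoc_linear[OF mods(1,3,4)] tm])
  have R: "?R \<in> carrier (tensor k (M x u) (tensor k (H u y) (H y z)))"
    by (rule linear_maps_closed[OF tensor_map_linear[OF mods(1,5,1) tens(2) id_map_linear[OF mods(1)] cop]
          linear_maps_closed[OF \<rho>xuz m]])
  have cL: "contract k (M x u) (tensor k (H u y) (H y z)) (tensor_functional k (H u y) (H y z) b a) ?L =
      act k A M (action M \<rho>) x y u (act k A M (action M \<rho>) x z y m a) b"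
    and cR: "contract k (M x u) (tensor k (H u y) (H y z)) (tensor_functional k (H u y) (H y z) b a) ?R =
      act k A M (action M \<rho>) x z u m
        (comp_map A z y u (pure_tensor k (dual_module k (H y z)) (dual_module k (H u y)) a b))"
    if a: "a \<in> carrier (dual_module k (H y z))" and b: "b \<in> carrier (dual_module k (H u y))" for a b
  proof -
    have "contract k (M x u) (tensor k (H u y) (H y z)) (tensor_functional k (H u y) (H y z) b a) ?L =
        contract k (M x u) (H u y) b (\<rho> x u y (contract k (M x y) (H y z) a (\<rho> x y z m)))"
      by (simp add: contract_tensor_assoc[OF mods(1,3,4) b a tm]
          contract_tensor_map_left[OF mods(2) tens(1) mods(4) \<rho>xuy a linear_maps_closed[OF \<rho>xyz m]])
    also have "\<dots> = act k A M (action M \<rho>) x y u (act k A M (action M \<rho>) x z y m a) b"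
      using X m a b linear_maps_closed[OF contract_linear[OF mods(2,4) a] linear_maps_closed[OF \<rho>xyz m]]
      by (simp add: act_action)
    finally show "contract k (M x u) (tensor k (H u y) (H y z)) (tensor_functional k (H u y) (H y z) b a) ?L =
      act k A M (action M \<rho>) x y u (act k A M (action M \<rho>) x z y m a) b" .
    note tf = tensor_functional_closed[OF mods(3,4) b a]
    show "contract k (M x u) (tensor k (H u y) (H y z)) (tensor_functional k (H u y) (H y z) b a) ?R =
      act k A M (action M \<rho>) x z u m
        (comp_map A z y u (pure_tensor k (dual_module k (H y z)) (dual_module k (H u y)) a b))"
      using X m by (simp add: contract_tensor_map_right[OF mods(1,5) tens(2) cop tf linear_maps_closed[OF \<rho>xuz m]]
          comp_map_A_pure[OF X(4,3,2) a b] act_action dual_module_compose[OF mods(5) tf cop])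
  qed
  obtain I d c where I: "dual_basis k (H u y) (I :: 'c set) d c"
    by (rule hom_dual_basis[OF X(2,3)])
  obtain J e f where J: "dual_basis k (H y z) (J :: 'c set) e f"
    by (rule hom_dual_basis[OF X(3,4)])
  have "?L = ?R \<longleftrightarrow> (\<forall>a\<in>carrier (dual_module k (H y z)). \<forall>b\<in>carrier (dual_module k (H u y)).
      contract k (M x u) (tensor k (H u y) (H y z)) (tensor_functional k (H u y) (H y z) b a) ?L =
      contract k (M x u) (tensor k (H u y) (H y z)) (tensor_functional k (H u y) (H y z) b a) ?R)"
    using dual_basisD(2)[OF I] dual_basisD(2)[OF J]
    by (auto intro!: tensor_contract_eqI[OF mods(1) tens(2) tensor_dual_basis[OF mods(3,4) I J] L R])
  then show ?thesis by (simp add: cL cR)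
qed

lemma counital_iff_unital:
  assumes X: "x \<in> X" "z \<in> X" and m: "m \<in> carrier (M x z)"
  shows "right_unitor k (M x z) (tensor_map k (M x z) (H z z) (M x z) (ring_module k)
      (id_map (M x z)) (counit C z) (\<rho> x z z m)) = act k A M (action M \<rho>) x z z m (unit_elem A z)"
  using X m
  by (simp add: act_action counit_dual right_unitor_contract fgp_families_module[OF M] comod_hom_module
      linear_maps_closed[OF coactions_linear[OF \<rho>]])

lemma right_comodules_iff_right_modules:
  "(M, \<rho>) \<in> right_comodules k X C \<longleftrightarrow> (M, action M \<rho>) \<in> right_modules k X A"
proof -
  have "(M, \<rho>) \<in> right_comodules k X C \<longleftrightarrow>
      (\<forall>x\<in>X. \<forall>u\<in>X. \<forall>y\<in>X. \<forall>z\<in>X. \<forall>m\<in>carrier (M x z).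
        \<forall>a\<in>carrier (mod_hom A z y). \<forall>b\<in>carrier (mod_hom A y u).
        act k A M (action M \<rho>) x y u (act k A M (action M \<rho>) x z y m a) b
        = act k A M (action M \<rho>) x z u m (comp_map A z y u (pure_tensor k (mod_hom A z y) (mod_hom A y u) a b))) \<and>
      (\<forall>x\<in>X. \<forall>z\<in>X. \<forall>m\<in>carrier (M x z). act k A M (action M \<rho>) x z z m (unit_elem A z) = m)"
    using M \<rho>[unfolded coactions_def]
    by (simp add: right_comodules_def coassociative_iff_associative counital_iff_unital
        del: mod_hom_A unit_elem_A cong: ball_cong)
  also have "\<dots> \<longleftrightarrow> (M, action M \<rho>) \<in> right_modules k X A"
    using M action_in[OF M \<rho>, unfolded actions_def] by (simp add: right_modules_def) blast
  finally show ?thesis .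
qed

end

lemma comodule_maps_eq_module_maps:
  fixes M :: "('x, 'k, 'm) family" and N :: "('x, 'k, 'n) family"
  assumes M: "M \<in> fgp_families k X" and \<rho>: "\<rho> \<in> coactions M"
    and N: "N \<in> fgp_families k X" and \<sigma>: "\<sigma> \<in> coactions N"
  shows "comodule_maps k X C (M, \<rho>) (N, \<sigma>) = module_maps k X A (M, action M \<rho>) (N, action N \<sigma>)"
proof -
  have "tensor_map k (M x y) (H y z) (N x y) (H y z) (f x y) (id_map (H y z)) (\<rho> x y z m) = \<sigma> x y z (f x z m)
    \<longleftrightarrow> (\<forall>a\<in>carrier (mod_hom A z y).
      f x y (act k A M (action M \<rho>) x z y m a) = act k A N (action N \<sigma>) x z y (f x z m) a)" (is "?L = ?R \<longleftrightarrow> _")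
    if f: "f \<in> family_maps k X M N" and X: "x \<in> X" "y \<in> X" "z \<in> X" and m: "m \<in> carrier (M x z)"
    for f x y z m
  proof -
    have mods: "module k (M x y)" "module k (N x y)" "module k (H y z)"
      using X M N by (auto intro: fgp_families_module comod_hom_module)
    note fxy = family_maps_linear[OF f X(1,2)]
    have fm: "f x z m \<in> carrier (N x z)" using linear_maps_closed[OF family_maps_linear[OF f X(1,3)] m] .
    have \<rho>m: "\<rho> x y z m \<in> carrier (tensor k (M x y) (H y z))"
      using linear_maps_closed[OF coactions_linear[OF \<rho> X] m] .
    have L: "?L \<in> carrier (tensor k (N x y) (H y z))"
      by (rule linear_maps_closed[OF tensor_map_linear[OF mods(1,3,2,3) fxy id_map_linear[OF mods(3)]] \<rho>m])
    have R: "?R \<in> carrier (tensor k (N x y) (H y z))"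
      using linear_maps_closed[OF coactions_linear[OF \<sigma> X] fm] .
    obtain I d c where I: "dual_basis k (H y z) (I :: 'c set) d c"
      by (rule hom_dual_basis[OF X(2,3)])
    have "?L = ?R \<longleftrightarrow> (\<forall>a\<in>carrier (dual_module k (H y z)).
        contract k (N x y) (H y z) a ?L = contract k (N x y) (H y z) a ?R)"
      using contract_eqI[OF mods(2,3) I L R] by auto
    then show ?thesis
      using X m fm
      by (simp add: contract_tensor_map_left[OF mods(1,2,3) fxy _ \<rho>m] act_action[OF M \<rho>] act_action[OF N \<sigma>])
  qed
  note iff = this
  show ?thesis
    unfolding comodule_maps_def module_maps_def prod.case
  proof (intro Collect_cong conj_cong refl)
    fix f assume "f \<in> family_maps k X M N"
    then show "(\<forall>x\<in>X. \<forall>y\<in>X. \<forall>z\<in>X. \<forall>m\<in>carrier (M x z).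
        tensor_map k (M x y) (H y z) (N x y) (H y z) (f x y) (id_map (H y z)) (\<rho> x y z m) = \<sigma> x y z (f x z m))
      \<longleftrightarrow> (\<forall>x\<in>X. \<forall>y\<in>X. \<forall>z\<in>X. \<forall>m\<in>carrier (M x y). \<forall>a\<in>carrier (mod_hom A y z).
        f x z (act k A M (action M \<rho>) x y z m a) = act k A N (action N \<sigma>) x y z (f x y m) a)"
      by (simp add: iff del: mod_hom_A cong: ball_cong) blast
  qed
qed

theorem comodule_category_isomorphic_module_category:
  "isomorphic_categories
    (comodule_category k X C :: ('x, 'k, 'm, 'c) comodule_cat)
    (module_category k X A :: ('x, 'k, 'm, 'c \<Rightarrow> 'k) module_cat)"
proof (rule isomorphic_categoriesI)
  show "category (module_category k X A :: ('x, 'k, 'm, 'c \<Rightarrow> 'k) module_cat)"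
    by (rule module_category_category) (simp add: dual_module_module comod_hom_module)
  have comod: "M \<in> fgp_families k X \<and> \<rho> \<in> coactions M" if "(M, \<rho>) \<in> right_comodules k X C"
    for M :: "('x, 'k, 'm) family" and \<rho>
    using that by (simp add: right_comodules_def coactions_def)
  have mod: "M \<in> fgp_families k X \<and> \<mu> \<in> actions M" if "(M, \<mu>) \<in> right_modules k X A"
    for M :: "('x, 'k, 'm) family" and \<mu>
    using that by (simp add: right_modules_def actions_def)
  define F where "F = (\<lambda>(M :: ('x, 'k, 'm) family, \<rho>). (M, action M \<rho>))"
  define G where "G = (\<lambda>(M :: ('x, 'k, 'm) family, \<mu>). (M, coaction M \<mu>))"
  note defs = comodule_category_def module_category_def F_def G_def
  {
    fix P :: "('x, 'k, 'm) family \<times> ('x, 'k, 'm, 'c \<Rightarrow> 'k) action"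
    assume P: "P \<in> Obj (module_category k X A)"
    obtain M \<mu> where M\<mu>: "P = (M, \<mu>)" "(M, \<mu>) \<in> right_modules k X A"
      using P by (cases P) (simp add: module_category_def)
    note M = mod[OF M\<mu>(2), THEN conjunct1] and \<mu> = mod[OF M\<mu>(2), THEN conjunct2]
    show "F (G P) = P" by (simp add: defs M\<mu>(1) action_coaction[OF M \<mu>])
    show "G P \<in> Obj (comodule_category k X C)"
      using M\<mu>(2)
      by (simp add: defs M\<mu>(1) action_coaction[OF M \<mu>]
          right_comodules_iff_right_modules[OF M coaction_in[OF M \<mu>]])
  }
  fix P Q R :: "('x, 'k, 'm) family \<times> ('x, 'k, 'm, 'c) coaction"
  assume P: "P \<in> Obj (comodule_category k X C)"
  then obtain M \<rho> where M\<rho>: "P = (M, \<rho>)" "(M, \<rho>) \<in> right_comodules k X C"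
    by (cases P) (simp add: comodule_category_def)
  note M = comod[OF M\<rho>(2), THEN conjunct1] and \<rho> = comod[OF M\<rho>(2), THEN conjunct2]
  show "F P \<in> Obj (module_category k X A)" "G (F P) = P"
    "Ident (comodule_category k X C) P = Ident (module_category k X A) (F P)"
    using M\<rho>(2)
    by (simp_all add: defs M\<rho>(1) right_comodules_iff_right_modules[OF M \<rho>] coaction_action[OF M \<rho>])
  show "Compose (comodule_category k X C) P Q R = Compose (module_category k X A) (F P) (F Q) (F R)"
    by (simp add: defs M\<rho>(1))
  assume "Q \<in> Obj (comodule_category k X C)"
  then obtain N \<sigma> where N\<sigma>: "Q = (N, \<sigma>)" "(N, \<sigma>) \<in> right_comodules k X C"
    by (cases Q) (simp add: comodule_category_def)
  show "Arr (comodule_category k X C) P Q = Arr (module_category k X A) (F P) (F Q)"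
    using comod[OF N\<sigma>(2)] by (simp add: defs M\<rho>(1) N\<sigma>(1) comodule_maps_eq_module_maps[OF M \<rho>])
qed

end

theorem proposition4p4:
  fixes k :: "'k ring" and X :: "'x set" and C :: "('x, 'k, 'c) dual_linear_cat"
  assumes "dual_linear_category k X C"
    and "\<And>x y. \<lbrakk>x \<in> X; y \<in> X\<rbrakk> \<Longrightarrow> finitely_generated k (comod_hom C x y)"
    and "\<And>x y. \<lbrakk>x \<in> X; y \<in> X\<rbrakk> \<Longrightarrow> projective k (comod_hom C x y)"
  shows "isomorphic_categories
    (comodule_category k X C :: ('x, 'k, 'm, 'c) comodule_cat)
    (module_category k X (dual_to_linear_cat k C) :: ('x, 'k, 'm, 'c \<Rightarrow> 'k) module_cat)"
  using assms
  by (intro fgp_dual_linear_category.comodule_category_isomorphic_module_category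
      fgp_dual_linear_category.intro fgp_dual_linear_category_axioms.intro)

end
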